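(* Let $f\in\mathbb{R}[\boldsymbol{x}]$, $\boldsymbol{x}=(x_1,\ldots,x_n)$, let $G(\boldsymbol{x})$ be a $q\times q$ symmetric real polynomial matrix, $\mathbf{K}=\{\boldsymbol{x}\in\mathbb{R}^n\mid G(\boldsymbol{x})\succeq 0\}$, and $f^{\star}=\min_{\boldsymbol{x}\in\mathbf{K}}f(\boldsymbol{x})$. For $m\in\mathbb{N}$ let $f^{\star}_m=\sup\{r\in\mathbb{R}\mid f(\boldsymbol{x})-r\in\mathcal{H}_m(G)\}$. Suppose that either (a) $G(\boldsymbol{x})$ is linear, and $\mathbf{K}$ is compact with nonempty interior; or (b) $G(\boldsymbol{x})$ is nonlinear, $\mathbf{K}$ is compact, $I_q-G(\boldsymbol{x})\succeq 0$ on $\mathbf{K}$, and $\mathbb{R}[\boldsymbol{x}]=\mathcal{H}(G)-\mathcal{H}(G)$. Then $f^{\star}_m\uparrow f^{\star}$ as $m\to\infty$, i.e. the sequence $(f^{\star}_m)_m$ is nondecreasing and converges to $f^{\star}$.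
   Context: $\mathbb{R}[\boldsymbol{x}]$ is the ring of real polynomials in $\boldsymbol{x}$; $\mathbb{N}$ is the set of nonnegative integers; $\mathbb{R}_+$ the nonnegative reals; $[m]=\{1,\ldots,m\}$. $\mathbb{S}^{p}_+$ is the set of $p\times p$ real symmetric positive semidefinite matrices; $\langle A,B\rangle=\mathrm{tr}(A^{\intercal}B)$; $U^{\otimes k}$ is the $k$-fold Kronecker power. "Linear" means $G(\boldsymbol{x})=A_0+\sum_{i=1}^nA_ix_i$ with symmetric $A_i$. For $m\in\mathbb{N}$: - if $G$ is linear, $\mathcal{H}_m(G):=\{\lambda_0+\sum_{k=1}^m\langle\Lambda_k,G(\boldsymbol{x})^{\otimes k}\rangle\mid\lambda_0\in\mathbb{R}_+,\ \Lambda_k\in\mathbb{S}^{q^k}_+,\ k\in[m]\}$; - if $G$ is nonlinear, with $\widetilde{G}(\boldsymbol{x})=\mathrm{diag}(G(\boldsymbol{x}),I_q-G(\boldsymbol{x}))$, $\mathcal{H}_m(G):=\{\lambda_0+\sum_{k=1}^m\langle\Lambda_k,\widetilde{G}(\boldsymbol{x})^{\otimes k}\rangle\mid\lambda_0\in\mathbb{R}_+,\ \Lambda_k\in\mathbb{S}^{(2q)^k}_+,\ k\in[m]\}$. In both cases $\mathcal{H}(G):=\bigcup_{m\in\mathbb{N}}\mathcal{H}_m(G)$. The supremum of the empty set is $-\infty$. Writing $f^\star$ as a minimum presupposes $\mathbf{K}\neq\emptyset$. *)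

theory Defs
  imports "HOL-Analysis.Analysis" "HOL-Library.Poly_Mapping" "Jordan_Normal_Form.Matrix"
begin

text \<open>The ring of real polynomials in the variables \<open>x\<^sub>i\<close>, with \<open>i\<close> ranging over the finite
  type \<open>'n\<close>: finitely supported maps from exponent vectors to coefficients, with the
  convolution product of \<open>Poly_Mapping\<close>.\<close>

type_synonym 'n rpoly = "('n \<Rightarrow>\<^sub>0 nat) \<Rightarrow>\<^sub>0 real"

definition pconst :: "real \<Rightarrow> 'n rpoly" where
  "pconst c = Poly_Mapping.single 0 c"

definition pvar :: "'n \<Rightarrow> 'n rpoly" where
  "pvar i = Poly_Mapping.single (Poly_Mapping.single i 1) 1"

definition peval :: "'n::finite rpoly \<Rightarrow> real ^ 'n \<Rightarrow> real" where
  "peval p x = (\<Sum>\<alpha>\<in>Poly_Mapping.keys p.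
     Poly_Mapping.lookup p \<alpha> * (\<Prod>i\<in>UNIV. vec_nth x i ^ Poly_Mapping.lookup \<alpha> i))"

definition pmat_eval :: "'n::finite rpoly mat \<Rightarrow> real ^ 'n \<Rightarrow> real mat" where
  "pmat_eval G x = map_mat (\<lambda>p. peval p x) G"

definition sym_mat :: "'a mat \<Rightarrow> bool" where
  "sym_mat A \<longleftrightarrow> transpose_mat A = A"

definition psd_mats :: "nat \<Rightarrow> real mat set" where
  "psd_mats p = {A \<in> carrier_mat p p. sym_mat A \<and>
     (\<forall>v\<in>carrier_vec p. 0 \<le> scalar_prod v (A *\<^sub>v v))}"

definition mat_trace :: "'a::comm_monoid_add mat \<Rightarrow> 'a" where
  "mat_trace A = (\<Sum>i<dim_row A. A $$ (i, i))"

definition kronecker :: "'a::times mat \<Rightarrow> 'a mat \<Rightarrow> 'a mat" where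
  "kronecker A B = Matrix.mat (dim_row A * dim_row B) (dim_col A * dim_col B)
     (\<lambda>(i, j). A $$ (i div dim_row B, j div dim_col B) * B $$ (i mod dim_row B, j mod dim_col B))"

fun kron_pow :: "'a::{times,zero,one} mat \<Rightarrow> nat \<Rightarrow> 'a mat" where
  "kron_pow A 0 = 1\<^sub>m 1"
| "kron_pow A (Suc k) = kronecker A (kron_pow A k)"

text \<open>The pairing of a real matrix with a polynomial matrix; the real entries are read as
  constant polynomials.\<close>

definition pmat_inner :: "real mat \<Rightarrow> 'n rpoly mat \<Rightarrow> 'n rpoly" where
  "pmat_inner L P = mat_trace (transpose_mat (map_mat pconst L) * P)"

definition linear_pmat :: "'n::finite rpoly mat \<Rightarrow> bool" where
  "linear_pmat G \<longleftrightarrow> (\<exists>A\<^sub>0 A. A\<^sub>0 \<in> carrier_mat (dim_row G) (dim_row G) \<and> sym_mat A\<^sub>0 \<and>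
     (\<forall>v. A v \<in> carrier_mat (dim_row G) (dim_row G) \<and> sym_mat (A v)) \<and>
     G = Matrix.mat (dim_row G) (dim_row G)
       (\<lambda>(i, j). pconst (A\<^sub>0 $$ (i, j)) + (\<Sum>v\<in>UNIV. pconst (A v $$ (i, j)) * pvar v)))"

definition tilde_pmat :: "'n rpoly mat \<Rightarrow> 'n rpoly mat" where
  "tilde_pmat G = diag_block_mat [G, 1\<^sub>m (dim_row G) - G]"

definition kron_cone :: "'n rpoly mat \<Rightarrow> nat \<Rightarrow> 'n rpoly set" where
  "kron_cone M m = {pconst l\<^sub>0 + (\<Sum>k=1..m. pmat_inner (\<Lambda> k) (kron_pow M k)) | l\<^sub>0 \<Lambda>.
     0 \<le> l\<^sub>0 \<and> (\<forall>k\<in>{1..m}. \<Lambda> k \<in> psd_mats (dim_row M ^ k))}"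

definition handelman :: "'n::finite rpoly mat \<Rightarrow> nat \<Rightarrow> 'n rpoly set" where
  "handelman G m = (if linear_pmat G then kron_cone G m else kron_cone (tilde_pmat G) m)"

definition handelman_all :: "'n::finite rpoly mat \<Rightarrow> 'n rpoly set" where
  "handelman_all G = (\<Union>m. handelman G m)"

definition feasible :: "'n::finite rpoly mat \<Rightarrow> (real ^ 'n) set" where
  "feasible G = {x. pmat_eval G x \<in> psd_mats (dim_row G)}"

text \<open>A minimum, hence unspecified unless it is attained.\<close>

definition opt_val :: "'n::finite rpoly \<Rightarrow> 'n rpoly mat \<Rightarrow> real" where
  "opt_val f G = (LEAST v. v \<in> peval f ` feasible G)"

definition relax_val :: "'n::finite rpoly \<Rightarrow> 'n rpoly mat \<Rightarrow> nat \<Rightarrow> ereal" where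
  "relax_val f G m = Sup (ereal ` {r. f - pconst r \<in> handelman G m})"

end

theory Submission
  imports Defs
begin

text \<open>
  Let \<open>K\<close> be the feasible set and let \<open>M\<close> be \<open>G\<close> in the linear case and \<open>diag(G, I - G)\<close> in the
  nonlinear case. The union \<open>T\<close> of the cones at all levels contains the nonnegative constants and is closed under addition, and
  also under multiplication: by the mixed product rule
  \<open>\<langle>\<Lambda>, M\<^sup>\<otimes>\<^sup>k\<rangle> \<langle>\<Lambda>', M\<^sup>\<otimes>\<^sup>l\<rangle> = \<langle>\<Lambda> \<otimes> \<Lambda>', M\<^sup>\<otimes>\<^sup>(\<^sup>k\<^sup>+\<^sup>l\<^sup>)\<rangle>\<close>, where \<open>\<Lambda> \<otimes> \<Lambda>'\<close> is positive semidefinite. So \<open>T\<close> is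
  a preprime of the polynomial ring. A point at which every element of \<open>T\<close> is nonnegative is a
  point at which \<open>M\<close> is positive semidefinite, that is, a point of \<open>K\<close>; the converse is the
  positivity of the trace pairing, together with the hypothesis \<open>I - G \<succeq> 0\<close> on \<open>K\<close> in the
  nonlinear case.

  The theorem then follows from the Krivine--Kadison--Dubois representation theorem
  (\<open>positive_on_characters_imp_mem\<close>): an Archimedean preprime contains each element on which all
  its real characters are positive. Applied to \<open>f - r\<close> with \<open>r < min f\<close> this places \<open>f - r\<close> in the
  cone of some level, hence of all later levels, while no level gives a value above the minimum
  because its elements are nonnegative on \<open>K\<close>.

  What has to be shown is that \<open>T\<close> is Archimedean, and here the two cases need different arguments.
  In the nonlinear case \<open>M\<close> has the constant trace \<open>q\<close>, so \<open>tr M\<^sup>\<otimes>\<^sup>k = q\<^sup>k\<close> and, for \<open>b\<close> large enough,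
  \<open>b q\<^sup>k - \<langle>\<Lambda>, M\<^sup>\<otimes>\<^sup>k\<rangle> = \<langle>b I - \<Lambda>, M\<^sup>\<otimes>\<^sup>k\<rangle>\<close> lies in \<open>T\<close> (\<open>constant_trace_bound\<close>). This bounds the elements
  of \<open>T\<close>, and every polynomial is a difference of two of them.
  In the linear case \<open>G = A\<^sub>0 + \<Sum> x\<^sub>v A\<^sub>v\<close>, the convex cone of the vectors \<open>(\<langle>\<Lambda>, A\<^sub>v\<rangle>)\<^sub>v\<close>, with \<open>\<Lambda>\<close> positive
  semidefinite, is the whole space: a hyperplane bounding it would have a normal \<open>d\<close> with \<open>\<Sum> d\<^sub>v A\<^sub>v\<close>
  positive semidefinite, and \<open>K\<close> would contain a ray in direction \<open>d\<close>. So every \<open>\<plusminus> x\<^sub>v\<close> is,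
  up to a constant, some \<open>\<langle>\<Lambda>, G\<rangle>\<close>; the variables are bounded with respect to \<open>T\<close>, and the
  elements bounded with respect to a preprime form a subring (\<open>linear_archimedean\<close>).
\<close>

section \<open>Archimedean preprimes\<close>

text \<open>The map \<open>c\<close> embeds the scalars. It is a parameter so that the results apply to rings that are
  not instances of a class of real algebras.\<close>

locale preprime =
  fixes c :: "real \<Rightarrow> 'a::comm_ring_1" and T :: "'a set"
  assumes c_add: "c (a + b) = c a + c b"
    and c_mult: "c (a * b) = c a * c b"
    and c_one: "c 1 = 1"
    and c_mem: "0 \<le> a \<Longrightarrow> c a \<in> T"
    and add_mem: "s \<in> T \<Longrightarrow> t \<in> T \<Longrightarrow> s + t \<in> T"
    and mult_mem: "s \<in> T \<Longrightarrow> t \<in> T \<Longrightarrow> s * t \<in> T"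
begin

lemma c_zero: "c 0 = 0"
  using c_add[of 0 0] by simp

lemma c_minus: "c (- a) = - c a"
  using c_add[of a "- a"] c_zero by (simp add: add_eq_0_iff)

lemma c_diff: "c (a - b) = c a - c b"
  using c_add[of a "- b"] c_minus[of b] by simp

lemma one_mem: "1 \<in> T" and zero_mem: "0 \<in> T"
  using c_mem[of 1] c_mem[of 0] by (simp_all add: c_one c_zero)

lemma c_cancel: "a \<noteq> 0 \<Longrightarrow> c (1 / a) * (c a * p) = p"
  using c_mult[of "1 / a" a] by (simp add: c_one mult.assoc[symmetric])

definition bounded_elems :: "'a set" where
  "bounded_elems = {p. \<exists>N. c N - p \<in> T \<and> c N + p \<in> T}"

lemma bound_mono:
  assumes "c N - p \<in> T" "N \<le> N'"
  shows "c N' - p \<in> T"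
proof -
  have "c N' - p = c (N' - N) + (c N - p)" by (simp add: c_diff)
  with assms add_mem c_mem show ?thesis by (metis diff_ge_0_iff_ge)
qed

lemma bounded_elemsE:
  assumes "p \<in> bounded_elems"
  obtains N where "0 \<le> N" "c N - p \<in> T" "c N + p \<in> T"
proof -
  obtain N where N: "c N - p \<in> T" "c N - (- p) \<in> T"
    using assms by (auto simp: bounded_elems_def)
  show thesis
    by (rule that[of "max N 0"]) (use bound_mono[OF N(1)] bound_mono[OF N(2)] in auto)
qed

lemma bounded_elems_const: "c a \<in> bounded_elems"
proof -
  have "c \<bar>a\<bar> - c a \<in> T" "c \<bar>a\<bar> + c a \<in> T"
    using c_mem[of "\<bar>a\<bar> - a"] c_mem[of "\<bar>a\<bar> + a"] by (simp_all add: c_add c_diff)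
  then show ?thesis unfolding bounded_elems_def by blast
qed

lemma bounded_elems_add:
  assumes "p \<in> bounded_elems" "q \<in> bounded_elems"
  shows "p + q \<in> bounded_elems"
proof -
  obtain N where N: "c N - p \<in> T" "c N + p \<in> T" using assms(1) by (rule bounded_elemsE)
  obtain M where M: "c M - q \<in> T" "c M + q \<in> T" using assms(2) by (rule bounded_elemsE)
  have "c (N + M) - (p + q) = (c N - p) + (c M - q)" "c (N + M) + (p + q) = (c N + p) + (c M + q)"
    by (simp_all add: c_add)
  then show ?thesis unfolding bounded_elems_def using add_mem N M by (metis (mono_tags, lifting) mem_Collect_eq)
qed

text \<open>The product of the bounds is a bound for the product because twice
  \<open>N M - p q\<close> is \<open>(N - p) (M + q) + (N + p) (M - q)\<close>, and similarly for \<open>N M + p q\<close>. Together with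
  the previous lemmas: the bounded elements form a subring.\<close>

lemma bounded_elems_mult:
  assumes "p \<in> bounded_elems" "q \<in> bounded_elems"
  shows "p * q \<in> bounded_elems"
proof -
  obtain N where N: "c N - p \<in> T" "c N + p \<in> T" using assms(1) by (rule bounded_elemsE)
  obtain M where M: "c M - q \<in> T" "c M + q \<in> T" using assms(2) by (rule bounded_elemsE)
  have 2: "c 2 = 2" using c_add[of 1 1] by (simp add: c_one)
  have "(c N - p) * (c M + q) + (c N + p) * (c M - q) = c 2 * (c (N * M) - p * q)"
    "(c N + p) * (c M + q) + (c N - p) * (c M - q) = c 2 * (c (N * M) + p * q)"
    by (simp_all add: c_mult 2 algebra_simps)
  then have "c 2 * (c (N * M) - p * q) \<in> T" "c 2 * (c (N * M) + p * q) \<in> T"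
    using N M add_mem mult_mem by metis+
  then have "c (1/2) * (c 2 * (c (N * M) - p * q)) \<in> T" "c (1/2) * (c 2 * (c (N * M) + p * q)) \<in> T"
    using mult_mem c_mem by simp_all
  then have "c (N * M) - p * q \<in> T" "c (N * M) + p * q \<in> T"
    using c_cancel[of 2] by simp_all
  then show ?thesis unfolding bounded_elems_def by blast
qed

text \<open>The analogue of a quadratic module, with \<open>T\<close> in the role of the sums of squares.\<close>

definition proper_module :: "'a set \<Rightarrow> bool" where
  "proper_module Q \<longleftrightarrow> T \<subseteq> Q \<and> (\<forall>a\<in>Q. \<forall>b\<in>Q. a + b \<in> Q) \<and> (\<forall>t\<in>T. \<forall>a\<in>Q. t * a \<in> Q) \<and> - 1 \<notin> Q"

lemma proper_moduleD:
  assumes "proper_module Q"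
  shows "t \<in> T \<Longrightarrow> t \<in> Q" "a \<in> Q \<Longrightarrow> b \<in> Q \<Longrightarrow> a + b \<in> Q" "t \<in> T \<Longrightarrow> a \<in> Q \<Longrightarrow> t * a \<in> Q" "- 1 \<notin> Q"
  using assms by (auto simp: proper_module_def)

definition maximal_module :: "'a set \<Rightarrow> bool" where
  "maximal_module Q \<longleftrightarrow> proper_module Q \<and> (\<forall>Q'. proper_module Q' \<longrightarrow> Q \<subseteq> Q' \<longrightarrow> Q' = Q)"

lemma maximal_module_exists:
  assumes "proper_module Q0"
  shows "\<exists>Q. maximal_module Q \<and> Q0 \<subseteq> Q"
proof -
  let ?A = "{Q. proper_module Q \<and> Q0 \<subseteq> Q}"
  have "\<Union>C \<in> ?A" if C: "C \<noteq> {}" "subset.chain ?A C" for C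
  proof -
    have mem: "proper_module X \<and> Q0 \<subseteq> X" if "X \<in> C" for X
      using C(2) that by (auto simp: subset.chain_def)
    have "a + b \<in> \<Union>C" if ab: "a \<in> \<Union>C" "b \<in> \<Union>C" for a b
    proof -
      obtain X Y where XY: "X \<in> C" "Y \<in> C" "a \<in> X" "b \<in> Y" using ab by blast
      then have "X \<subseteq> Y \<or> Y \<subseteq> X" using C(2) unfolding subset.chain_def by blast
      then have "a + b \<in> X \<or> a + b \<in> Y" using XY mem proper_moduleD(2) by (metis subsetD)
      then show ?thesis using XY by blast
    qed
    moreover have "T \<subseteq> \<Union>C" "Q0 \<subseteq> \<Union>C"
      using C(1) mem unfolding proper_module_def by blast+
    moreover have "\<forall>t\<in>T. \<forall>a\<in>\<Union>C. t * a \<in> \<Union>C" "- 1 \<notin> \<Union>C"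
      using mem unfolding proper_module_def by blast+
    ultimately show ?thesis by (simp add: proper_module_def)
  qed
  then obtain Q where "Q \<in> ?A" "\<forall>X\<in>?A. Q \<subseteq> X \<longrightarrow> X = Q"
    using subset_Zorn_nonempty[of ?A] assms by blast
  then have "maximal_module Q \<and> Q0 \<subseteq> Q" unfolding maximal_module_def by blast
  then show ?thesis ..
qed

end

locale archimedean_preprime = preprime +
  assumes archimedean: "\<exists>N. c N - p \<in> T"
begin

lemma bound_nonneg:
  obtains N where "0 \<le> N" "c N - p \<in> T"
proof -
  obtain N where N: "c N - p \<in> T" using archimedean by blast
  show thesis by (rule that[of "max N 0"]) (use bound_mono[OF N] in auto)
qed

text \<open>A maximal proper module \<open>Q\<close> induces a total preorder. If \<open>p\<close> were incomparable to \<open>0\<close>,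
  adjoining \<open>p\<close> and adjoining \<open>- p\<close> would both produce \<open>- 1\<close>, say \<open>- 1 = a + p s = b - p t\<close>.
  Eliminating \<open>p\<close> puts \<open>- s\<close> into \<open>Q\<close>. Squares need not lie in \<open>T\<close>; instead the boundedness of
  \<open>p\<close> turns this into \<open>p s \<in> Q\<close>, so that \<open>- 1 = a + p s\<close> would lie in \<open>Q\<close>.\<close>

lemma maximal_module_total:
  assumes max: "maximal_module Q"
  shows "p \<in> Q \<or> - p \<in> Q"
proof (rule ccontr)
  have Q: "proper_module Q" using max by (simp add: maximal_module_def)
  note D = proper_moduleD[OF Q]
  have ext: "\<exists>a\<in>Q. \<exists>s\<in>T. - 1 = a + p * s" if "p \<notin> Q" for p
  proof (rule ccontr)
    assume none: "\<not> (\<exists>a\<in>Q. \<exists>s\<in>T. - 1 = a + p * s)"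
    let ?Q = "{a + p * s | a s. a \<in> Q \<and> s \<in> T}"
    have 1: "a \<in> ?Q" if "a \<in> Q" for a
      using that zero_mem by force
    have 2: "u + v \<in> ?Q" if uv: "u \<in> ?Q" "v \<in> ?Q" for u v
    proof -
      obtain a s where "u = a + p * s" "a \<in> Q" "s \<in> T" using uv by blast
      moreover obtain b t where "v = b + p * t" "b \<in> Q" "t \<in> T" using uv by blast
      ultimately have "u + v = (a + b) + p * (s + t)" "a + b \<in> Q" "s + t \<in> T"
        using D(2) add_mem by (simp_all add: distrib_left)
      then show ?thesis by blast
    qed
    have 3: "t * u \<in> ?Q" if tu: "t \<in> T" "u \<in> ?Q" for t u
    proof -
      obtain a s where "u = a + p * s" "a \<in> Q" "s \<in> T" using tu by blast
      then have "t * u = t * a + p * (t * s)" "t * a \<in> Q" "t * s \<in> T"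
        using D(3) mult_mem tu(1) by (simp_all add: distrib_left mult.left_commute)
      then show ?thesis by blast
    qed
    have "proper_module ?Q"
      unfolding proper_module_def using 1 2 3 D(1) none by blast
    then have "?Q = Q" using max 1 unfolding maximal_module_def by blast
    moreover have "p \<in> ?Q" using D(1)[OF zero_mem] one_mem by force
    ultimately show False using that by blast
  qed
  assume "\<not> (p \<in> Q \<or> - p \<in> Q)"
  then obtain a s b t where a: "a \<in> Q" "s \<in> T" "- 1 = a + p * s"
    and b: "b \<in> Q" "t \<in> T" "- 1 = b + (- p) * t"
    using ext[of p] ext[of "- p"] by blast
  have ps: "p * s = - 1 - a" unfolding a(3) by simp
  have "p * t = b - (- 1)" unfolding b(3) by simp
  then have pt: "p * t = 1 + b" by simp
  have "t * (- 1 - a) = s * (1 + b)"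
    using arg_cong[OF ps, of "\<lambda>x. t * x"] arg_cong[OF pt, of "\<lambda>x. s * x"] by (simp add: ac_simps)
  then have "- s = t + t * a + s * b" by (simp add: algebra_simps neg_eq_iff_add_eq_0)
  then have s: "- s \<in> Q" using D a b by metis
  obtain M where M: "0 \<le> M" "c M - p \<in> T" by (rule bound_nonneg)
  have "(c M - p) * (- s) \<in> Q" by (rule D(3)[OF _ s]) (use M in simp)
  moreover have "c M * s \<in> Q" using M a(2) c_mem mult_mem D(1) by simp
  ultimately have "(c M - p) * (- s) + c M * s \<in> Q" by (rule D(2))
  then have "p * s \<in> Q" by (simp add: algebra_simps)
  then have "- 1 \<in> Q" using a D(2) by simp
  then show False using D(4) by simp
qed

text \<open>The order of a maximal module is total and Archimedean, so each \<open>p\<close> determines a cut in the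
  reals, and \<open>\<phi> p\<close> is the real number of that cut. Multiplicativity on \<open>T\<close> is monotonicity
  of multiplication by elements of \<open>T\<close>, and it extends to the ring because every \<open>p\<close> is
  \<open>c N - (c N - p)\<close>, a difference of elements of \<open>T\<close>.\<close>

lemma maximal_module_character:
  assumes max: "maximal_module Q"
  shows "\<exists>\<phi> :: 'a \<Rightarrow> real. (\<forall>a. \<phi> (c a) = a) \<and> (\<forall>p q. \<phi> (p + q) = \<phi> p + \<phi> q) \<and>
    (\<forall>p q. \<phi> (p * q) = \<phi> p * \<phi> q) \<and> (\<forall>p\<in>Q. 0 \<le> \<phi> p)"
proof -
  have Q: "proper_module Q" using max by (simp add: maximal_module_def)
  note D = proper_moduleD[OF Q]
  define S where "S p = {r. p - c r \<in> Q}" for p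
  define \<phi> where "\<phi> p = Sup (S p)" for p
  have neg: "c r \<notin> Q" if "r < 0" for r
  proof
    assume "c r \<in> Q"
    then have "c (1 / (- r)) * c r \<in> Q" using D(3) c_mem that by simp
    moreover have "c (1 / (- r)) * c r = - 1"
      using that c_mult[of "1 / (- r)" r] by (simp add: c_minus c_one)
    ultimately show False using D(4) by simp
  qed
  have sep: "r \<le> r'" if "p - c r \<in> Q" "c r' - p \<in> Q" for p r r'
  proof -
    have "c (r' - r) \<in> Q" using D(2)[OF that] by (simp add: c_diff)
    then show ?thesis using neg[of "r' - r"] by force
  qed
  have ne: "S p \<noteq> {}" for p
  proof -
    obtain N where "c N - (- p) \<in> T" using archimedean by blast
    then have "p - c (- N) \<in> Q" using D(1) by (simp add: c_minus add.commute)
    then show ?thesis by (auto simp: S_def)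
  qed
  have bdd: "bdd_above (S p)" for p
  proof -
    obtain N where "c N - p \<in> T" using archimedean by blast
    then have "c N - p \<in> Q" using D(1) by simp
    then have "r \<le> N" if "r \<in> S p" for r using sep that by (simp add: S_def)
    then show ?thesis by (meson bdd_above.I)
  qed
  have le: "r \<le> \<phi> p" if "p - c r \<in> Q" for r p
    unfolding \<phi>_def using that bdd by (auto intro!: cSup_upper simp: S_def)
  have ge: "\<phi> p \<le> r" if "c r - p \<in> Q" for r p
    unfolding \<phi>_def by (rule cSup_least[OF ne]) (use sep that in \<open>auto simp: S_def\<close>)
  have below: "p - c r \<in> Q" if "r < \<phi> p" for r p
    using maximal_module_total[OF max, of "p - c r"] ge[of r p] that by force
  have above: "c r - p \<in> Q" if "\<phi> p < r" for r p
    using maximal_module_total[OF max, of "p - c r"] le[of p r] that by force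
  have const: "\<phi> (c a) = a" for a
    using le[of "c a" a] ge[of a "c a"] D(1)[OF zero_mem] by simp
  have nonneg: "0 \<le> \<phi> p" if "p \<in> Q" for p
    using le[of p 0] that by (simp add: c_zero)
  have add: "\<phi> (p + q) = \<phi> p + \<phi> q" for p q
  proof (rule antisym; rule field_le_epsilon)
    fix e :: real assume "0 < e"
    then have "(c (\<phi> p + e/2) - p) + (c (\<phi> q + e/2) - q) \<in> Q" using above D(2) by simp
    also have "(c (\<phi> p + e/2) - p) + (c (\<phi> q + e/2) - q) = c ((\<phi> p + e/2) + (\<phi> q + e/2)) - (p + q)"
      unfolding c_add[of "\<phi> p + e/2"] by simp
    finally show "\<phi> (p + q) \<le> \<phi> p + \<phi> q + e" by (auto dest: ge)
  next
    fix e :: real assume "0 < e"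
    then have "(p - c (\<phi> p - e/2)) + (q - c (\<phi> q - e/2)) \<in> Q" using below D(2) by simp
    also have "(p - c (\<phi> p - e/2)) + (q - c (\<phi> q - e/2)) = (p + q) - c ((\<phi> p - e/2) + (\<phi> q - e/2))"
      unfolding c_add[of "\<phi> p - e/2"] by simp
    finally have "\<phi> p - e/2 + (\<phi> q - e/2) \<le> \<phi> (p + q)" by (rule le)
    then show "\<phi> p + \<phi> q \<le> \<phi> (p + q) + e" by simp
  qed
  have minus: "\<phi> (- p) = - \<phi> p" for p
    using add[of p "- p"] const[of 0] by (simp add: c_zero)
  have mono: "\<phi> p \<le> \<phi> q" if "q - p \<in> Q" for p q
    using nonneg[OF that] add[of q "- p"] minus[of p] by simp
  have scale: "\<phi> (t * c r) = r * \<phi> t" if "0 \<le> r" "t \<in> T" for t r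
  proof (cases "r = 0")
    case True
    then show ?thesis using const[of 0] by (simp add: c_zero)
  next
    case False
    with that have r: "0 < r" by simp
    have up: "r * a \<le> \<phi> (t * c r)" if "a < \<phi> t" for a
    proof (rule le)
      have "c r * (t - c a) \<in> Q" using below that D(3) c_mem r by simp
      then show "t * c r - c (r * a) \<in> Q" by (simp add: c_mult algebra_simps)
    qed
    have dn: "\<phi> (t * c r) \<le> r * a" if "\<phi> t < a" for a
    proof (rule ge)
      have "c r * (c a - t) \<in> Q" using above that D(3) c_mem r by simp
      then show "c (r * a) - t * c r \<in> Q" by (simp add: c_mult algebra_simps)
    qed
    have "\<phi> (t * c r) / r = \<phi> t"
    proof (rule antisym; rule field_le_epsilon)
      fix e :: real assume "0 < e"
      then show "\<phi> (t * c r) / r \<le> \<phi> t + e" using dn[of "\<phi> t + e"] r by (simp add: field_simps)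
    next
      fix e :: real assume "0 < e"
      then show "\<phi> t \<le> \<phi> (t * c r) / r + e" using up[of "\<phi> t - e"] r by (simp add: field_simps)
    qed
    then show ?thesis using r by (simp add: field_simps)
  qed
  have scale': "\<phi> (t * c r) = r * \<phi> t" if "t \<in> T" for t r
  proof (cases "0 \<le> r")
    case True then show ?thesis using scale that by simp
  next
    case False
    then show ?thesis using scale[of "- r" t] that minus[of "t * c r"] by (simp add: c_minus)
  qed
  have multT: "\<phi> (t * p) = \<phi> t * \<phi> p" if t: "t \<in> T" for t p
  proof -
    have t0: "0 \<le> \<phi> t" using nonneg D(1) t by simp
    have lo: "r * \<phi> t \<le> \<phi> (t * p)" if "r < \<phi> p" for r
    proof -
      have "t * p - t * c r \<in> Q" using D(3)[OF t below[OF that]] by (simp add: algebra_simps)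
      from mono[OF this] show ?thesis using scale'[OF t] by simp
    qed
    have hi: "\<phi> (t * p) \<le> r * \<phi> t" if "\<phi> p < r" for r
    proof -
      have "t * c r - t * p \<in> Q" using D(3)[OF t above[OF that]] by (simp add: algebra_simps)
      from mono[OF this] show ?thesis using scale'[OF t] by simp
    qed
    show ?thesis
    proof (rule antisym; rule field_le_epsilon)
      fix e :: real assume e: "0 < e"
      \<comment> \<open>The summand \<open>1\<close> keeps the denominator positive when \<open>\<phi> t = 0\<close>.\<close>
      define d where "d = e / (\<phi> t + 1)"
      have d: "0 < d" "d * \<phi> t \<le> e" using e t0 by (auto simp: d_def field_simps)
      show "\<phi> (t * p) \<le> \<phi> t * \<phi> p + e"
        using hi[of "\<phi> p + d"] d by (simp add: algebra_simps)
      show "\<phi> t * \<phi> p \<le> \<phi> (t * p) + e"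
        using lo[of "\<phi> p - d"] d by (simp add: algebra_simps)
    qed
  qed
  have mult: "\<phi> (p * q) = \<phi> p * \<phi> q" for p q
  proof -
    obtain N where N: "0 \<le> N" "c N - p \<in> T" by (rule bound_nonneg)
    have "\<phi> ((c N - p) * q) = \<phi> (c N * q) - \<phi> (p * q)"
      using add[of "c N * q" "- (p * q)"] minus by (simp add: algebra_simps)
    moreover have "\<phi> (c N * q) = N * \<phi> q" using multT[OF c_mem[OF N(1)]] const by simp
    moreover have "\<phi> ((c N - p) * q) = (N - \<phi> p) * \<phi> q"
      using multT[OF N(2)] add[of "c N" "- p"] minus const by simp
    ultimately show ?thesis by (simp add: algebra_simps)
  qed
  show ?thesis by (intro exI[of _ \<phi>] conjI allI ballI const add mult nonneg)
qed

text \<open>From any \<open>r \<ge> 0\<close> with \<open>f + r\<close> in \<open>T\<close> one can pass to \<open>r - 1/N\<close>, where \<open>N\<close> bounds \<open>s\<close>: the element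
  \<open>(N - s) (f + r) + t + r s\<close> lies in \<open>T\<close> and equals \<open>N f + N r - 1\<close>. The decrement does not depend on
  \<open>r\<close>, so finitely many steps reach \<open>r = 0\<close>.\<close>

lemma denominator_removal:
  assumes s: "s \<in> T" and t: "t \<in> T" and eq: "f * s = 1 + t"
  shows "f \<in> T"
proof -
  obtain N0 where N0: "0 \<le> N0" "c N0 - s \<in> T" by (rule bound_nonneg)
  define N where "N = N0 + 1"
  have N: "0 < N" "c N - s \<in> T" using N0 bound_mono[OF N0(2), of N] by (simp_all add: N_def)
  have step: "f + c (r - 1 / N) \<in> T" if r: "0 \<le> r" "f + c r \<in> T" for r
  proof -
    have "(c N - s) * (f + c r) + t + c r * s \<in> T"
      using N r s t add_mem mult_mem c_mem by simp
    moreover have "(c N - s) * (f + c r) + t + c r * s = c N * f + c (N * r - 1)"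
      using eq by (simp add: c_diff c_mult c_one algebra_simps)
    ultimately have "c (1 / N) * (c N * f + c (N * r - 1)) \<in> T"
      using mult_mem c_mem N by simp
    moreover have "c (1 / N) * (c N * f + c (N * r - 1)) = f + c (r - 1 / N)"
      using c_cancel[of N f] c_mult[of "1 / N" "N * r - 1"] N by (simp add: distrib_left algebra_simps)
    ultimately show ?thesis by simp
  qed
  obtain R where R: "c R - (- f) \<in> T" using archimedean by blast
  have iter: "f + c (max 0 (R - real k / N)) \<in> T" for k
  proof (induction k)
    case 0
    then show ?case using bound_mono[OF R, of "max 0 R"] by (simp add: add.commute)
  next
    case (Suc k)
    have "c (max 0 (R - real k / N) - 1 / N) - (- f) \<in> T"
      using step[OF _ Suc.IH] by (simp add: add.commute)
    then have "c (max 0 (R - real (Suc k) / N)) - (- f) \<in> T"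
    proof (rule bound_mono)
      have "0 < 1 / N" using N by simp
      moreover have "real (Suc k) / N = real k / N + 1 / N" by (simp add: add_divide_distrib)
      ultimately show "max 0 (R - real k / N) - 1 / N \<le> max 0 (R - real (Suc k) / N)"
        by linarith
    qed
    then show ?case by (simp add: add.commute)
  qed
  obtain k where "R * N \<le> real k" using real_arch_simple by blast
  then have "max 0 (R - real k / N) = 0" using N by (simp add: field_simps)
  then show ?thesis using iter[of k] by (simp add: c_zero)
qed

text \<open>If the module \<open>T - f T\<close> were proper, a maximal module above it would give a character that is
  nonnegative on \<open>T\<close> and on \<open>- f\<close>. So \<open>- 1\<close> lies in \<open>T - f T\<close>, which is an identity \<open>f s = 1 + t\<close>.\<close>

theorem positive_on_characters_imp_mem:
  assumes pos: "\<And>\<phi>. \<lbrakk>\<And>a. \<phi> (c a) = a; \<And>p q. \<phi> (p + q) = \<phi> p + \<phi> q;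
      \<And>p q. \<phi> (p * q) = \<phi> p * \<phi> q; \<And>t. t \<in> T \<Longrightarrow> 0 \<le> \<phi> t\<rbrakk> \<Longrightarrow> 0 < (\<phi> f :: real)"
  shows "f \<in> T"
proof -
  let ?Q = "{t - f * s | s t. s \<in> T \<and> t \<in> T}"
  have "\<not> proper_module ?Q"
  proof
    assume "proper_module ?Q"
    then obtain Q where Q: "maximal_module Q" "?Q \<subseteq> Q"
      using maximal_module_exists by blast
    have "proper_module Q" using Q(1) by (simp add: maximal_module_def)
    obtain \<phi> :: "'a \<Rightarrow> real" where \<phi>: "\<forall>a. \<phi> (c a) = a" "\<forall>p q. \<phi> (p + q) = \<phi> p + \<phi> q"
      "\<forall>p q. \<phi> (p * q) = \<phi> p * \<phi> q" "\<forall>p\<in>Q. 0 \<le> \<phi> p"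
      using maximal_module_character[OF Q(1)] by (elim exE conjE)
    have "- f \<in> ?Q" using zero_mem one_mem by force
    then have "0 \<le> \<phi> (- f)" using \<phi>(4) Q(2) by blast
    moreover have "\<phi> (- f) = - \<phi> f"
      using \<phi>(2)[rule_format, of f "- f"] \<phi>(1)[rule_format, of 0] by (simp add: c_zero)
    moreover have "0 < \<phi> f"
      by (rule pos) (use \<phi> proper_moduleD(1)[OF \<open>proper_module Q\<close>] in auto)
    ultimately show False by simp
  qed
  moreover have "t \<in> ?Q" if "t \<in> T" for t
    using that zero_mem by force
  moreover have "u + v \<in> ?Q" if uv: "u \<in> ?Q" "v \<in> ?Q" for u v
  proof -
    obtain s t where "u = t - f * s" "t \<in> T" "s \<in> T" using uv by blast
    moreover obtain s' t' where "v = t' - f * s'" "t' \<in> T" "s' \<in> T" using uv by blast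
    ultimately have "u + v = (t + t') - f * (s + s')" "t + t' \<in> T" "s + s' \<in> T"
      by (simp_all add: distrib_left add_mem)
    then show ?thesis by blast
  qed
  moreover have "w * u \<in> ?Q" if wu: "w \<in> T" "u \<in> ?Q" for w u
  proof -
    obtain s t where "u = t - f * s" "t \<in> T" "s \<in> T" using wu by blast
    then have "w * u = w * t - f * (w * s)" "w * t \<in> T" "w * s \<in> T"
      using mult_mem wu(1) by (simp_all add: right_diff_distrib mult.left_commute)
    then show ?thesis by blast
  qed
  ultimately have "- 1 \<in> ?Q" unfolding proper_module_def by blast
  then obtain s t where "s \<in> T" "t \<in> T" "- 1 = t - f * s" by blast
  moreover from this have "f * s = 1 + t" by (simp add: algebra_simps)
  ultimately show ?thesis using denominator_removal by blast
qed

end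

section \<open>Evaluation and characters of the polynomial ring\<close>

lemma poly_eq_sum_terms:
  "p = (\<Sum>\<alpha>\<in>Poly_Mapping.keys p. Poly_Mapping.single \<alpha> (Poly_Mapping.lookup p \<alpha>))"
  by (rule poly_mapping_eqI)
    (auto simp: lookup_sum lookup_single when_def not_in_keys_iff_lookup_eq_zero sum.delta)

lemma peval_superset:
  assumes "finite S" "Poly_Mapping.keys p \<subseteq> S"
  shows "peval p x = (\<Sum>\<alpha>\<in>S. Poly_Mapping.lookup p \<alpha> * (\<Prod>i\<in>UNIV. vec_nth x i ^ Poly_Mapping.lookup \<alpha> i))"
  unfolding peval_def using assms
  by (intro sum.mono_neutral_left) (auto simp: not_in_keys_iff_lookup_eq_zero)

lemma peval_add [simp]: "peval (p + q) x = peval p x + peval q x"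
proof -
  let ?S = "Poly_Mapping.keys p \<union> Poly_Mapping.keys q"
  have "peval r x = (\<Sum>\<alpha>\<in>?S. Poly_Mapping.lookup r \<alpha> * (\<Prod>i\<in>UNIV. vec_nth x i ^ Poly_Mapping.lookup \<alpha> i))"
    if "r \<in> {p, q, p + q}" for r
    using that keys_add[of p q] by (intro peval_superset) auto
  then show ?thesis by (simp add: lookup_add distrib_right sum.distrib)
qed

lemma peval_zero [simp]: "peval 0 x = 0"
  by (simp add: peval_def)

lemma peval_sum [simp]: "peval (sum g A) x = (\<Sum>a\<in>A. peval (g a) x)"
  by (induction A rule: infinite_finite_induct) auto

lemma peval_minus [simp]: "peval (- p) x = - peval p x"
  using peval_add[of p "- p" x] by simp

lemma peval_diff [simp]: "peval (p - q) x = peval p x - peval q x"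
  using peval_add[of p "- q" x] by simp

lemma peval_single:
  "peval (Poly_Mapping.single \<alpha> a) x = a * (\<Prod>i\<in>UNIV. vec_nth x i ^ Poly_Mapping.lookup \<alpha> i)"
  by (cases "a = 0") (simp_all add: peval_def)

lemma peval_mult [simp]: "peval (p * q) x = peval p x * peval q x"
proof -
  let ?t = "\<lambda>p \<alpha>. Poly_Mapping.single \<alpha> (Poly_Mapping.lookup p \<alpha>)"
  have "peval (p * q) x = peval ((\<Sum>\<alpha>\<in>Poly_Mapping.keys p. ?t p \<alpha>) * (\<Sum>\<beta>\<in>Poly_Mapping.keys q. ?t q \<beta>)) x"
    using poly_eq_sum_terms by metis
  also have "\<dots> = (\<Sum>\<alpha>\<in>Poly_Mapping.keys p. \<Sum>\<beta>\<in>Poly_Mapping.keys q. peval (?t p \<alpha>) x * peval (?t q \<beta>) x)"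
    by (simp add: sum_product mult_single peval_single lookup_add power_add prod.distrib ac_simps)
  also have "\<dots> = peval (\<Sum>\<alpha>\<in>Poly_Mapping.keys p. ?t p \<alpha>) x * peval (\<Sum>\<beta>\<in>Poly_Mapping.keys q. ?t q \<beta>) x"
    by (simp add: sum_product)
  finally show ?thesis by (simp flip: poly_eq_sum_terms)
qed

lemma peval_pconst [simp]: "peval (pconst a) x = a"
  by (simp add: pconst_def peval_single)

lemma peval_one [simp]: "peval 1 x = 1"
  using peval_pconst[of 1 x] by (simp add: pconst_def)

lemma pconst_add: "pconst (a + b) = pconst a + pconst b"
  by (simp add: pconst_def single_add)

lemma pconst_mult: "pconst (a * b) = pconst a * pconst b"
  by (simp add: pconst_def mult_single)

lemma pconst_diff: "pconst (a - b) = pconst a - pconst b"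
  by (simp add: pconst_def single_diff)

lemma pconst_1: "pconst 1 = 1"
  by (simp add: pconst_def)

lemma pconst_0: "pconst 0 = 0"
  by (simp add: pconst_def)

lemma pconst_sum: "pconst (sum g A) = (\<Sum>a\<in>A. pconst (g a))"
  by (induction A rule: infinite_finite_induct) (auto simp: pconst_0 pconst_add)

lemma monomial_power: "pvar i ^ k = Poly_Mapping.single (Poly_Mapping.single i k) (1::real)"
  by (induction k) (simp_all add: pvar_def mult_single flip: single_add)

lemma prod_single_one:
  "finite A \<Longrightarrow> (\<Prod>i\<in>A. Poly_Mapping.single (h i) (1::real)) = Poly_Mapping.single (\<Sum>i\<in>A. h i) 1"
  by (induction A rule: finite_induct) (simp_all add: mult_single)

lemma single_eq_pconst_monomial:
  "Poly_Mapping.single \<alpha> a = pconst a * (\<Prod>i\<in>UNIV. pvar (i::'n::finite) ^ Poly_Mapping.lookup \<alpha> i)"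
proof -
  have "(\<Sum>i\<in>UNIV. Poly_Mapping.single i (Poly_Mapping.lookup \<alpha> i)) = \<alpha>"
    by (rule poly_mapping_eqI) (simp add: lookup_sum lookup_single when_def)
  then show ?thesis
    by (simp add: monomial_power prod_single_one pconst_def mult_single)
qed

lemma rpoly_induct [case_names const var add mult]:
  fixes p :: "'n::finite rpoly"
  assumes "\<And>a. P (pconst a)" "\<And>i. P (pvar i)"
    and "\<And>p q. P p \<Longrightarrow> P q \<Longrightarrow> P (p + q)" "\<And>p q. P p \<Longrightarrow> P q \<Longrightarrow> P (p * q)"
  shows "P p"
proof -
  have 0: "P 0" and 1: "P 1" using assms(1)[of 0] assms(1)[of 1] by (simp_all add: pconst_0 pconst_1)
  have sum: "P (sum g A)" if "\<And>a. a \<in> A \<Longrightarrow> P (g a)" for g :: "('n \<Rightarrow>\<^sub>0 nat) \<Rightarrow> 'n rpoly" and A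
    using that by (induction A rule: infinite_finite_induct) (auto simp: 0 assms(3))
  have prod: "P (prod g A)" if "\<And>a. P (g a)" for g :: "'n \<Rightarrow> 'n rpoly" and A
    using that by (induction A rule: infinite_finite_induct) (auto simp: 1 assms(4))
  have pow: "P (pvar i ^ k)" for i k
    by (induction k) (auto simp: 1 assms(2,4))
  have "P (Poly_Mapping.single \<alpha> a)" for \<alpha> a
    unfolding single_eq_pconst_monomial by (intro assms(1,4) prod pow)
  then have "P (\<Sum>\<alpha>\<in>Poly_Mapping.keys p. Poly_Mapping.single \<alpha> (Poly_Mapping.lookup p \<alpha>))"
    by (intro sum)
  then show ?thesis by (simp flip: poly_eq_sum_terms)
qed

lemma peval_pvar [simp]: "peval (pvar i) x = vec_nth x i"
proof -
  have "(\<Prod>j\<in>UNIV. vec_nth x j ^ Poly_Mapping.lookup (Poly_Mapping.single i 1) j)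
      = (\<Prod>j\<in>UNIV. if j = i then vec_nth x j else 1)"
    by (intro prod.cong) (auto simp: lookup_single when_def)
  then show ?thesis unfolding pvar_def peval_single by simp
qed

text \<open>The characters of the polynomial ring are the points of real space.\<close>

lemma character_eq_peval:
  fixes \<phi> :: "'n::finite rpoly \<Rightarrow> real"
  assumes "\<And>a. \<phi> (pconst a) = a" "\<And>p q. \<phi> (p + q) = \<phi> p + \<phi> q" "\<And>p q. \<phi> (p * q) = \<phi> p * \<phi> q"
  shows "\<phi> p = peval p (vec_lambda (\<lambda>i. \<phi> (pvar i)))"
  by (induction p rule: rpoly_induct) (simp_all add: assms)

lemma continuous_on_peval: "continuous_on S (peval p)"
  unfolding peval_def[abs_def] by (intro continuous_intros)

section \<open>Positive semidefinite matrices and Kronecker products\<close>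

text \<open>Positive semidefiniteness of the upper left \<open>p \<times> p\<close> block of an array indexed by all naturals.
  The size is an ordinary argument and no carriers intervene, which suits induction on the size
  and the index arithmetic of Kronecker products.\<close>

definition psd_fun :: "nat \<Rightarrow> (nat \<Rightarrow> nat \<Rightarrow> real) \<Rightarrow> bool" where
  "psd_fun p A \<longleftrightarrow> (\<forall>i<p. \<forall>j<p. A i j = A j i) \<and> (\<forall>u. 0 \<le> (\<Sum>i<p. \<Sum>j<p. A i j * (u i * u j)))"

lemma psd_fun_sym: "psd_fun p A \<Longrightarrow> i < p \<Longrightarrow> j < p \<Longrightarrow> A i j = A j i"
  by (simp add: psd_fun_def)

lemma psd_fun_nonneg: "psd_fun p A \<Longrightarrow> 0 \<le> (\<Sum>i<p. \<Sum>j<p. A i j * (u i * u j))"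
  unfolding psd_fun_def by blast

lemma psd_mats_iff:
  "A \<in> psd_mats p \<longleftrightarrow> A \<in> carrier_mat p p \<and> psd_fun p (\<lambda>i j. A $$ (i, j))"
proof (cases "A \<in> carrier_mat p p")
  case A: True
  have quad: "scalar_prod v (A *\<^sub>v v) = (\<Sum>i<p. \<Sum>j<p. A $$ (i, j) * (vec_index v i * vec_index v j))"
    if "v \<in> carrier_vec p" for v
    using A that by (auto simp: scalar_prod_def sum_distrib_left lessThan_atLeast0 ac_simps intro!: sum.cong)
  have "(\<forall>v\<in>carrier_vec p. 0 \<le> scalar_prod v (A *\<^sub>v v))
      \<longleftrightarrow> (\<forall>u. 0 \<le> (\<Sum>i<p. \<Sum>j<p. A $$ (i, j) * (u i * u j)))"
  proof (intro iffI allI ballI)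
    fix u :: "nat \<Rightarrow> real"
    assume "\<forall>v\<in>carrier_vec p. 0 \<le> scalar_prod v (A *\<^sub>v v)"
    then have "0 \<le> scalar_prod (Matrix.vec p u) (A *\<^sub>v Matrix.vec p u)" by simp
    then show "0 \<le> (\<Sum>i<p. \<Sum>j<p. A $$ (i, j) * (u i * u j))" by (simp add: quad)
  qed (simp add: quad)
  moreover have "sym_mat A \<longleftrightarrow> (\<forall>i<p. \<forall>j<p. A $$ (i, j) = A $$ (j, i))"
    using A by (auto simp: sym_mat_def mat_eq_iff)
  ultimately show ?thesis using A by (simp add: psd_mats_def psd_fun_def)
qed (simp add: psd_mats_def)

lemma sym_mat_index:
  assumes "sym_mat A" "A \<in> carrier_mat p p" "i < p" "j < p"
  shows "A $$ (i, j) = A $$ (j, i)"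
  using assms unfolding sym_mat_def by (metis carrier_matD index_transpose_mat(1))

text \<open>Otherwise the form takes the value \<open>A i i + 2 t A i j\<close> at \<open>e\<^sub>i + t e\<^sub>j\<close>, which is negative for a suitable \<open>t\<close>.\<close>

lemma psd_fun_zero_diagonal:
  assumes A: "psd_fun p A" and ij: "i < p" "j < p" and 0: "A j j = 0"
  shows "A i j = 0"
proof (cases "i = j")
  case False
  have quad: "0 \<le> A i i + 2 * t * A i j" for t
  proof -
    define u where "u = (\<lambda>k. if k = i then 1 else if k = j then t else (0::real))"
    have row: "(\<Sum>l<p. A k l * (u k * u l)) = u k * (A k i + t * A k j)" for k
    proof -
      have "(\<Sum>l<p. A k l * (u k * u l)) = (\<Sum>l\<in>{i, j}. A k l * (u k * u l))"
        by (rule sum.mono_neutral_right) (use ij in \<open>auto simp: u_def\<close>)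
      then show ?thesis using False by (simp add: u_def algebra_simps)
    qed
    have "(\<Sum>k<p. u k * (A k i + t * A k j)) = (\<Sum>k\<in>{i, j}. u k * (A k i + t * A k j))"
      by (rule sum.mono_neutral_right) (use ij in \<open>auto simp: u_def\<close>)
    also have "\<dots> = A i i + t * A i j + t * (A j i + t * A j j)" using False by (simp add: u_def)
    also have "\<dots> = A i i + 2 * t * A i j"
      using A ij 0 by (simp add: psd_fun_def)
    finally show ?thesis using A by (metis (no_types, lifting) psd_fun_def row sum.cong)
  qed
  show ?thesis
  proof (rule ccontr)
    assume ne: "A i j \<noteq> 0"
    have "0 \<le> A i i + 2 * (- (A i i + 1) / (2 * A i j)) * A i j" by (rule quad)
    moreover have "2 * (- (A i i + 1) / (2 * A i j)) * A i j = - (A i i + 1)"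
      using ne by (simp add: field_simps)
    ultimately show False by linarith
  qed
qed (use 0 in simp)

lemma quadratic_form_Suc:
  fixes u :: "nat \<Rightarrow> real"
  assumes sym: "\<And>i. i < p \<Longrightarrow> A p i = A i p"
  shows "(\<Sum>i<Suc p. \<Sum>j<Suc p. A i j * (u i * u j)) = (\<Sum>i<p. \<Sum>j<p. A i j * (u i * u j))
    + 2 * u p * (\<Sum>i<p. A i p * u i) + A p p * (u p)\<^sup>2"
proof -
  have "(\<Sum>j<p. A p j * (u p * u j)) = u p * (\<Sum>i<p. A i p * u i)"
    "(\<Sum>i<p. A i p * (u i * u p)) = u p * (\<Sum>i<p. A i p * u i)"
    using sym by (auto simp: sum_distrib_left ac_simps intro!: sum.cong)
  then show ?thesis by (simp add: sum.distrib power2_eq_square)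
qed

text \<open>Lagrange reduction: completing the square in the last variable splits off a rank one term and
  leaves a positive semidefinite form in one variable less. When the last diagonal entry is zero,
  so is its row, and with \<open>x / 0 = 0\<close> the same formulas cover this case.\<close>

lemma psd_fun_gram:
  assumes "psd_fun p A"
  shows "\<exists>w. \<forall>i<p. \<forall>j<p. A i j = (\<Sum>l<p. w l i * w l j)"
  using assms
proof (induction p arbitrary: A)
  case (Suc p)
  have sym: "A i j = A j i" if "i \<le> p" "j \<le> p" for i j
    using Suc.prems that by (simp add: psd_fun_def)
  have diag: "0 \<le> A p p"
  proof -
    have "0 \<le> (\<Sum>i<Suc p. \<Sum>j<Suc p. A i j * ((if i = p then 1 else 0) * (if j = p then 1 else 0)))"
      using Suc.prems by (rule psd_fun_nonneg)
    also have "\<dots> = A p p" by (subst quadratic_form_Suc) (auto simp: sym)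
    finally show ?thesis .
  qed
  have zero: "A i p = 0" if "A p p = 0" "i \<le> p" for i
    using psd_fun_zero_diagonal[OF Suc.prems, of i p] that by simp
  define B where "B i j = A i j - A i p * A j p / A p p" for i j
  have "psd_fun p B"
    unfolding psd_fun_def
  proof (intro conjI allI impI)
    show "B i j = B j i" if "i < p" "j < p" for i j
      using that sym[of i j] by (simp add: B_def)
    fix u :: "nat \<Rightarrow> real"
    define s where "s = (\<Sum>i<p. A i p * u i)"
    define u' where "u' = u(p := - s / A p p)"
    have Q: "(\<Sum>i<p. \<Sum>j<p. A i j * (u' i * u' j)) = (\<Sum>i<p. \<Sum>j<p. A i j * (u i * u j))"
      "(\<Sum>i<p. A i p * u' i) = s"
      by (auto simp: u'_def s_def intro!: sum.cong)
    have "0 \<le> (\<Sum>i<Suc p. \<Sum>j<Suc p. A i j * (u' i * u' j))"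
      using Suc.prems by (rule psd_fun_nonneg)
    also have "\<dots> = (\<Sum>i<p. \<Sum>j<p. A i j * (u i * u j)) + 2 * u' p * s + A p p * (u' p)\<^sup>2"
      by (subst quadratic_form_Suc) (auto simp: sym Q)
    also have "\<dots> = (\<Sum>i<p. \<Sum>j<p. A i j * (u i * u j)) - s * s / A p p"
      by (cases "A p p = 0") (simp_all add: u'_def power2_eq_square)
    also have "s * s / A p p = (\<Sum>i<p. \<Sum>j<p. A i p * A j p / A p p * (u i * u j))"
      unfolding s_def sum_product sum_divide_distrib by (intro sum.cong) auto
    finally show "0 \<le> (\<Sum>i<p. \<Sum>j<p. B i j * (u i * u j))"
      by (simp add: B_def left_diff_distrib sum_subtractf)
  qed
  then obtain w where w: "\<And>i j. i < p \<Longrightarrow> j < p \<Longrightarrow> B i j = (\<Sum>l<p. w l i * w l j)"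
    using Suc.IH by blast
  define w' where "w' l i = (if l < p then if i < p then w l i else 0 else A i p / sqrt (A p p))" for l i
  have "A i j = (\<Sum>l<Suc p. w' l i * w' l j)" if "i < Suc p" "j < Suc p" for i j
  proof -
    have last: "w' p i * w' p j = A i p * A j p / A p p"
      using diag by (simp add: w'_def)
    show ?thesis
    proof (cases "i < p \<and> j < p")
      case True
      then have "(\<Sum>l<p. w' l i * w' l j) = B i j" using w by (auto simp: w'_def)
      then show ?thesis using last by (simp add: B_def)
    next
      case False
      then have "i = p \<or> j = p" using that by auto
      then have "(\<Sum>l<p. w' l i * w' l j) = 0" by (auto simp: w'_def intro!: sum.neutral)
      moreover have "A i p * A j p / A p p = A i j"
        using \<open>i = p \<or> j = p\<close> that zero[of i] zero[of j] sym[of i p] sym[of j p]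
        by (cases "A p p = 0") auto
      ultimately show ?thesis using last by simp
    qed
  qed
  then show ?case by blast
qed simp

lemma psd_fun_inner_nonneg:
  assumes "psd_fun p A" "psd_fun p B"
  shows "0 \<le> (\<Sum>i<p. \<Sum>j<p. A i j * B i j)"
proof -
  obtain w where w: "\<And>i j. i < p \<Longrightarrow> j < p \<Longrightarrow> A i j = (\<Sum>l<p. w l i * w l j)"
    using psd_fun_gram[OF assms(1)] by blast
  have "(\<Sum>i<p. \<Sum>j<p. A i j * B i j) = (\<Sum>i<p. \<Sum>j<p. \<Sum>l<p. B i j * (w l i * w l j))"
    using w by (auto simp: sum_distrib_left sum_distrib_right ac_simps intro!: sum.cong)
  also have "\<dots> = (\<Sum>i<p. \<Sum>l<p. \<Sum>j<p. B i j * (w l i * w l j))"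
    by (intro sum.cong refl sum.swap)
  also have "\<dots> = (\<Sum>l<p. \<Sum>i<p. \<Sum>j<p. B i j * (w l i * w l j))"
    by (rule sum.swap)
  also have "0 \<le> \<dots>"
    by (intro sum_nonneg psd_fun_nonneg assms(2))
  finally show ?thesis .
qed

text \<open>Indices of a Kronecker product are pairs of indices, coded by quotient and remainder.\<close>

lemma sum_lessThan_div_mod:
  fixes h :: "nat \<Rightarrow> nat \<Rightarrow> 'b::comm_monoid_add"
  shows "(\<Sum>i<a * b. h (i div b) (i mod b)) = (\<Sum>k<a. \<Sum>l<b. h k l)"
proof -
  have "(\<Sum>i<a * b. h (i div b) (i mod b)) = (\<Sum>k<a. \<Sum>l<b. h ((l + k * b) div b) ((l + k * b) mod b))"
    by (rule sum_mult_product)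
  also have "\<dots> = (\<Sum>k<a. \<Sum>l<b. h k l)" by (intro sum.cong refl) auto
  finally show ?thesis .
qed

text \<open>With a Gram representation \<open>A = \<Sum>\<^sub>l w\<^sub>l w\<^sub>l\<^sup>T\<close>, the form of \<open>A \<otimes> B\<close> at \<open>u\<close> is the sum over \<open>l\<close> of the form of \<open>B\<close>
  at the contraction \<open>y\<^sub>l\<close> of \<open>u\<close> with \<open>w\<^sub>l\<close>.\<close>

lemma psd_fun_kronecker:
  assumes A: "psd_fun a A" and B: "psd_fun b B"
  shows "psd_fun (a * b) (\<lambda>i j. A (i div b) (j div b) * B (i mod b) (j mod b))"
  unfolding psd_fun_def
proof (intro conjI allI impI)
  fix i j assume "i < a * b" "j < a * b"
  then have "0 < b" "i div b < a" "j div b < a" by (auto simp: less_mult_imp_div_less intro!: Nat.gr0I)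
  then show "A (i div b) (j div b) * B (i mod b) (j mod b) = A (j div b) (i div b) * B (j mod b) (i mod b)"
    using A B by (simp add: psd_fun_def)
next
  fix u :: "nat \<Rightarrow> real"
  obtain w where w: "\<And>i j. i < a \<Longrightarrow> j < a \<Longrightarrow> A i j = (\<Sum>l<a. w l i * w l j)"
    using psd_fun_gram[OF A] by blast
  define y where "y l s = (\<Sum>k<a. w l k * u (k * b + s))" for l s
  have u: "u i = u (i div b * b + i mod b)" for i by simp
  have "(\<Sum>i<a * b. \<Sum>j<a * b. A (i div b) (j div b) * B (i mod b) (j mod b) * (u i * u j))
     = (\<Sum>k<a. \<Sum>s<b. \<Sum>k'<a. \<Sum>s'<b. A k k' * B s s' * (u (k * b + s) * u (k' * b + s')))"
    by (subst u, subst (2) u, subst sum_lessThan_div_mod, subst sum_lessThan_div_mod) (rule refl)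
  also have "\<dots> = (\<Sum>k<a. \<Sum>s<b. \<Sum>k'<a. \<Sum>s'<b. \<Sum>l<a. B s s' * ((w l k * u (k * b + s)) * (w l k' * u (k' * b + s'))))"
    using w by (auto simp: sum_distrib_left sum_distrib_right ac_simps intro!: sum.cong)
  also have "\<dots> = (\<Sum>l<a. \<Sum>s<b. \<Sum>s'<b. B s s' * (y l s * y l s'))"
  proof -
    have "(\<Sum>k<a. \<Sum>s<b. \<Sum>k'<a. \<Sum>s'<b. \<Sum>l<a. g k s k' s' l)
      = (\<Sum>l<a. \<Sum>s<b. \<Sum>s'<b. \<Sum>k<a. \<Sum>k'<a. g k s k' s' l)" for g :: "nat \<Rightarrow> nat \<Rightarrow> nat \<Rightarrow> nat \<Rightarrow> nat \<Rightarrow> real"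
    proof -
      have "(\<Sum>k<a. \<Sum>s<b. \<Sum>k'<a. \<Sum>s'<b. \<Sum>l<a. g k s k' s' l)
        = (\<Sum>k<a. \<Sum>s<b. \<Sum>k'<a. \<Sum>l<a. \<Sum>s'<b. g k s k' s' l)"
        by (intro sum.cong refl sum.swap)
      also have "\<dots> = (\<Sum>k<a. \<Sum>s<b. \<Sum>l<a. \<Sum>k'<a. \<Sum>s'<b. g k s k' s' l)"
        by (intro sum.cong refl sum.swap)
      also have "\<dots> = (\<Sum>k<a. \<Sum>l<a. \<Sum>s<b. \<Sum>k'<a. \<Sum>s'<b. g k s k' s' l)"
        by (intro sum.cong refl sum.swap)
      also have "\<dots> = (\<Sum>l<a. \<Sum>k<a. \<Sum>s<b. \<Sum>k'<a. \<Sum>s'<b. g k s k' s' l)"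
        by (rule sum.swap)
      also have "\<dots> = (\<Sum>l<a. \<Sum>s<b. \<Sum>k<a. \<Sum>k'<a. \<Sum>s'<b. g k s k' s' l)"
        by (intro sum.cong refl sum.swap)
      also have "\<dots> = (\<Sum>l<a. \<Sum>s<b. \<Sum>k<a. \<Sum>s'<b. \<Sum>k'<a. g k s k' s' l)"
        by (intro sum.cong refl sum.swap)
      also have "\<dots> = (\<Sum>l<a. \<Sum>s<b. \<Sum>s'<b. \<Sum>k<a. \<Sum>k'<a. g k s k' s' l)"
        by (intro sum.cong refl sum.swap)
      finally show ?thesis .
    qed
    moreover have "B s s' * (y l s * y l s') = (\<Sum>k<a. \<Sum>k'<a. B s s' * ((w l k * u (k * b + s)) * (w l k' * u (k' * b + s'))))"
      for l s s'
    proof -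
      have "y l s * y l s' = (\<Sum>k<a. \<Sum>k'<a. (w l k * u (k * b + s)) * (w l k' * u (k' * b + s')))"
        unfolding y_def by (rule sum_product)
      then show ?thesis by (simp only: sum_distrib_left)
    qed
    ultimately show ?thesis by simp
  qed
  also have "0 \<le> \<dots>" by (intro sum_nonneg psd_fun_nonneg B)
  finally show "0 \<le> (\<Sum>i<a * b. \<Sum>j<a * b. A (i div b) (j div b) * B (i mod b) (j mod b) * (u i * u j))" .
qed

text \<open>Each product \<open>u i * u j\<close> is at most the squared length of \<open>u\<close>, so the sum of the absolute values of
  the entries serves as an upper bound for the largest eigenvalue.\<close>

lemma psd_fun_diagonal_minus:
  assumes sym: "\<And>i j. i < p \<Longrightarrow> j < p \<Longrightarrow> A i j = A j i"
  defines "b \<equiv> (\<Sum>i<p. \<Sum>j<p. \<bar>A i j\<bar>)"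
  shows "psd_fun p (\<lambda>i j. (if i = j then b else 0) - A i j)"
  unfolding psd_fun_def
proof (intro conjI allI impI)
  fix u :: "nat \<Rightarrow> real"
  define n where "n = (\<Sum>i<p. u i * u i)"
  have n: "u i * u i \<le> n" if "i < p" for i
    unfolding n_def using that by (intro member_le_sum) auto
  have "A i j * (u i * u j) \<le> \<bar>A i j\<bar> * n" if "i < p" "j < p" for i j
  proof -
    have "0 \<le> (\<bar>u i\<bar> - \<bar>u j\<bar>)\<^sup>2" by simp
    then have "2 * \<bar>u i * u j\<bar> \<le> u i * u i + u j * u j"
      by (simp add: power2_eq_square algebra_simps abs_mult)
    then have "\<bar>u i * u j\<bar> \<le> n" using n[OF that(1)] n[OF that(2)] by linarith
    then have "\<bar>A i j\<bar> * \<bar>u i * u j\<bar> \<le> \<bar>A i j\<bar> * n" by (rule mult_left_mono) simp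
    then show ?thesis by (metis abs_ge_self abs_mult order_trans)
  qed
  then have "(\<Sum>i<p. \<Sum>j<p. A i j * (u i * u j)) \<le> (\<Sum>i<p. \<Sum>j<p. \<bar>A i j\<bar> * n)"
    by (intro sum_mono) auto
  also have "\<dots> = b * n" by (simp add: b_def sum_distrib_right)
  also have "b * n = (\<Sum>i<p. \<Sum>j<p. (if i = j then b else 0) * (u i * u j))"
    by (simp add: n_def sum_distrib_left if_distrib[of "\<lambda>x. x * _"] sum.delta cong: if_cong)
  finally show "0 \<le> (\<Sum>i<p. \<Sum>j<p. ((if i = j then b else 0) - A i j) * (u i * u j))"
    by (simp add: left_diff_distrib sum_subtractf)
qed (simp add: sym)

lemma kronecker_carrier:
  "A \<in> carrier_mat a a \<Longrightarrow> B \<in> carrier_mat b b \<Longrightarrow> kronecker A B \<in> carrier_mat (a * b) (a * b)"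
  by (auto simp: kronecker_def)

lemma kronecker_index:
  assumes "A \<in> carrier_mat a a" "B \<in> carrier_mat b b" "i < a * b" "j < a * b"
  shows "kronecker A B $$ (i, j) = A $$ (i div b, j div b) * B $$ (i mod b, j mod b)"
  using assms by (auto simp: kronecker_def)

lemma kronecker_one: "B \<in> carrier_mat b b \<Longrightarrow> kronecker (1\<^sub>m 1) B = (B :: 'a::semiring_1 mat)"
  by (rule eq_matI) (auto simp: kronecker_def)

lemma kronecker_assoc:
  assumes A: "A \<in> carrier_mat a a" and B: "B \<in> carrier_mat b b" and C: "(C :: 'a::semigroup_mult mat) \<in> carrier_mat c c"
  shows "kronecker (kronecker A B) C = kronecker A (kronecker B C)"
proof (rule eq_matI)
  note AB = kronecker_carrier[OF A B] and BC = kronecker_carrier[OF B C]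
  note L = kronecker_carrier[OF AB C] and R = kronecker_carrier[OF A BC]
  show "dim_row (kronecker (kronecker A B) C) = dim_row (kronecker A (kronecker B C))"
    "dim_col (kronecker (kronecker A B) C) = dim_col (kronecker A (kronecker B C))"
    using L R by (simp_all add: mult.assoc)
  fix i j assume "i < dim_row (kronecker A (kronecker B C))" "j < dim_col (kronecker A (kronecker B C))"
  then have ij: "i < a * (b * c)" "j < a * (b * c)" using R by auto
  then have ij': "i < a * b * c" "j < a * b * c" by (simp_all add: mult.assoc)
  have c: "0 < c" "0 < b" using ij by (auto intro!: Nat.gr0I)
  have div: "k div c div b = k div (b * c)" for k by (simp add: div_mult2_eq[symmetric] mult.commute)
  have mod: "k div c mod b = k mod (b * c) div c" "k mod (b * c) mod c = k mod c" for k
    using c mod_mult2_eq[of k c b] by (simp_all add: mult.commute[of b c])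
  show "kronecker (kronecker A B) C $$ (i, j) = kronecker A (kronecker B C) $$ (i, j)"
    using c ij ij'
    by (simp add: kronecker_index[OF AB C] kronecker_index[OF A BC] kronecker_index[OF A B]
        kronecker_index[OF B C] less_mult_imp_div_less div mod mult.assoc)
qed

lemma kron_pow_carrier: "M \<in> carrier_mat p p \<Longrightarrow> kron_pow M k \<in> carrier_mat (p ^ k) (p ^ k)"
  by (induction k) (auto intro: kronecker_carrier)

lemma kron_pow_one: "(M :: 'a::semiring_1 mat) \<in> carrier_mat p p \<Longrightarrow> kron_pow M 1 = M"
  by (rule eq_matI) (auto simp: kronecker_def)

lemma kron_pow_add:
  assumes "(M :: 'a::semiring_1 mat) \<in> carrier_mat p p"
  shows "kronecker (kron_pow M k) (kron_pow M l) = kron_pow M (k + l)"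
proof (induction k)
  case (Suc k)
  then show ?case
    using kronecker_assoc[OF assms kron_pow_carrier[OF assms] kron_pow_carrier[OF assms], of k l] by simp
next
  case 0
  show ?case using kronecker_one[OF kron_pow_carrier[OF assms], of l] by simp
qed

lemma kron_pow_trace:
  assumes M: "(M :: 'a::comm_semiring_1 mat) \<in> carrier_mat p p"
  shows "(\<Sum>i<p ^ k. kron_pow M k $$ (i, i)) = (\<Sum>i<p. M $$ (i, i)) ^ k"
proof (induction k)
  case (Suc k)
  have "(\<Sum>i<p * p ^ k. kronecker M (kron_pow M k) $$ (i, i))
      = (\<Sum>i<p * p ^ k. M $$ (i div p ^ k, i div p ^ k) * kron_pow M k $$ (i mod p ^ k, i mod p ^ k))"
    by (intro sum.cong) (auto simp: kronecker_index[OF M kron_pow_carrier[OF M]])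
  also have "\<dots> = (\<Sum>i<p. M $$ (i, i)) * (\<Sum>j<p ^ k. kron_pow M k $$ (j, j))"
    using sum_lessThan_div_mod[of "\<lambda>i j. M $$ (i, i) * kron_pow M k $$ (j, j)" "p ^ k" p]
    unfolding sum_product .
  finally show ?case using Suc by simp
qed simp

lemma psd_mats_kronecker:
  assumes A: "A \<in> psd_mats a" and B: "B \<in> psd_mats b"
  shows "kronecker A B \<in> psd_mats (a * b)"
proof -
  have car: "A \<in> carrier_mat a a" "B \<in> carrier_mat b b" using A B by (simp_all add: psd_mats_iff)
  have psd: "psd_fun (a * b) (\<lambda>i j. A $$ (i div b, j div b) * B $$ (i mod b, j mod b))"
    using psd_fun_kronecker A B unfolding psd_mats_iff by blast
  show ?thesis
    unfolding psd_mats_iff using psd kronecker_carrier[OF car]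
    by (simp add: psd_fun_def kronecker_index[OF car] cong: sum.cong_simp)
qed

lemma psd_mats_kron_pow:
  assumes "M \<in> psd_mats p"
  shows "kron_pow M k \<in> psd_mats (p ^ k)"
proof (induction k)
  case 0
  then show ?case by (simp add: psd_mats_iff psd_fun_def)
qed (simp add: psd_mats_kronecker assms)

lemma pmat_eval_carrier: "P \<in> carrier_mat p p \<Longrightarrow> pmat_eval P x \<in> carrier_mat p p"
  by (simp add: pmat_eval_def)

lemma pmat_eval_index:
  "P \<in> carrier_mat p p \<Longrightarrow> i < p \<Longrightarrow> j < p \<Longrightarrow> pmat_eval P x $$ (i, j) = peval (P $$ (i, j)) x"
  by (simp add: pmat_eval_def)

lemma pmat_eval_kronecker: "pmat_eval (kronecker P R) x = kronecker (pmat_eval P x) (pmat_eval R x)"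
proof (rule eq_matI)
  fix i j assume "i < dim_row (kronecker (pmat_eval P x) (pmat_eval R x))"
    "j < dim_col (kronecker (pmat_eval P x) (pmat_eval R x))"
  then have ij: "i < dim_row P * dim_row R" "j < dim_col P * dim_col R"
    by (simp_all add: kronecker_def pmat_eval_def)
  then have "0 < dim_row R" "0 < dim_col R" by (auto intro!: Nat.gr0I)
  then show "pmat_eval (kronecker P R) x $$ (i, j) = kronecker (pmat_eval P x) (pmat_eval R x) $$ (i, j)"
    using ij by (simp add: kronecker_def pmat_eval_def less_mult_imp_div_less)
qed (simp_all add: kronecker_def pmat_eval_def)

lemma pmat_eval_kron_pow: "pmat_eval (kron_pow M k) x = kron_pow (pmat_eval M x) k"
proof (induction k)
  case 0
  show ?case by (rule eq_matI) (simp_all add: pmat_eval_def)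
qed (simp add: pmat_eval_kronecker)

lemma pmat_inner_eq_sum:
  assumes "L \<in> carrier_mat p p" "P \<in> carrier_mat p p"
  shows "pmat_inner L P = (\<Sum>i<p. \<Sum>j<p. pconst (L $$ (i, j)) * P $$ (i, j))"
proof -
  have "pmat_inner L P = (\<Sum>j<p. \<Sum>i<p. pconst (L $$ (i, j)) * P $$ (i, j))"
    using assms
    by (auto simp: pmat_inner_def mat_trace_def scalar_prod_def lessThan_atLeast0 intro!: sum.cong)
  also have "\<dots> = (\<Sum>i<p. \<Sum>j<p. pconst (L $$ (i, j)) * P $$ (i, j))" by (rule sum.swap)
  finally show ?thesis .
qed

lemma peval_pmat_inner:
  assumes "L \<in> carrier_mat p p" "P \<in> carrier_mat p p"
  shows "peval (pmat_inner L P) x = (\<Sum>i<p. \<Sum>j<p. L $$ (i, j) * pmat_eval P x $$ (i, j))"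
  using assms by (simp add: pmat_inner_eq_sum pmat_eval_index)

text \<open>The mixed product rule for the pairing; it makes the cone below multiplicatively closed.\<close>

lemma pmat_inner_mult:
  assumes L: "L \<in> carrier_mat a a" "L' \<in> carrier_mat b b" and P: "P \<in> carrier_mat a a" "P' \<in> carrier_mat b b"
  shows "pmat_inner L P * pmat_inner L' P' = pmat_inner (kronecker L L') (kronecker P P')"
proof -
  let ?g = "\<lambda>k l s t. pconst (L $$ (k, l)) * P $$ (k, l) * (pconst (L' $$ (s, t)) * P' $$ (s, t))"
  have "pmat_inner (kronecker L L') (kronecker P P')
    = (\<Sum>i<a * b. \<Sum>j<a * b. ?g (i div b) (j div b) (i mod b) (j mod b))"
    unfolding pmat_inner_eq_sum[OF kronecker_carrier[OF L] kronecker_carrier[OF P]]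
    by (intro sum.cong refl) (simp add: kronecker_index[OF L] kronecker_index[OF P] pconst_mult ac_simps)
  also have "\<dots> = (\<Sum>k<a. \<Sum>s<b. \<Sum>l<a. \<Sum>t<b. ?g k l s t)"
    by (subst sum_lessThan_div_mod, subst sum_lessThan_div_mod) (rule refl)
  also have "\<dots> = (\<Sum>k<a. \<Sum>l<a. \<Sum>s<b. \<Sum>t<b. ?g k l s t)"
    by (intro sum.cong refl sum.swap)
  also have "\<dots> = (\<Sum>k<a. \<Sum>l<a. pconst (L $$ (k, l)) * P $$ (k, l) * pmat_inner L' P')"
    unfolding pmat_inner_eq_sum[OF L(2) P(2)] by (simp only: sum_distrib_left)
  also have "\<dots> = pmat_inner L P * pmat_inner L' P'"
    unfolding pmat_inner_eq_sum[OF L(1) P(1)] by (simp only: sum_distrib_right)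
  finally show ?thesis ..
qed

lemma pmat_inner_zero: "P \<in> carrier_mat p p \<Longrightarrow> pmat_inner (0\<^sub>m p p) P = 0"
  by (simp add: pmat_inner_eq_sum[of _ p] pconst_0)

lemma pmat_inner_add:
  assumes "L \<in> carrier_mat p p" "L' \<in> carrier_mat p p" "P \<in> carrier_mat p p"
  shows "pmat_inner (L + L') P = pmat_inner L P + pmat_inner L' P"
  using assms by (simp add: pmat_inner_eq_sum[of _ p] pconst_add distrib_right sum.distrib)

lemma psd_mats_add: "A \<in> psd_mats p \<Longrightarrow> B \<in> psd_mats p \<Longrightarrow> A + B \<in> psd_mats p"
  by (auto simp: psd_mats_iff psd_fun_def distrib_right sum.distrib)

lemma psd_mats_zero: "0\<^sub>m p p \<in> psd_mats p"
  by (simp add: psd_mats_iff psd_fun_def)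

lemma psd_mats_smult: "0 \<le> c \<Longrightarrow> A \<in> psd_mats p \<Longrightarrow> c \<cdot>\<^sub>m A \<in> psd_mats p"
  by (auto simp: psd_mats_iff psd_fun_def mult.assoc simp flip: sum_distrib_left)

lemma psd_mats_rank_one: "Matrix.mat p p (\<lambda>(i, j). v i * v j) \<in> psd_mats p"
proof -
  have "(\<Sum>i<p. \<Sum>j<p. v i * v j * (u i * u j)) = (\<Sum>i<p. v i * u i) * (\<Sum>i<p. v i * u i)" for u
    by (simp add: sum_product ac_simps)
  then show ?thesis by (simp add: psd_mats_iff psd_fun_def)
qed

section \<open>The Kronecker cone of a polynomial matrix\<close>

definition kron_cone_all :: "'n rpoly mat \<Rightarrow> 'n rpoly set" where
  "kron_cone_all M = (\<Union>m. kron_cone M m)"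

context
  fixes M :: "'n::finite rpoly mat" and p :: nat
  assumes M: "M \<in> carrier_mat p p"
begin

lemma kron_cone_mono:
  assumes "m \<le> m'"
  shows "kron_cone M m \<subseteq> kron_cone M m'"
proof
  fix h assume "h \<in> kron_cone M m"
  then obtain l0 \<Lambda> where h: "h = pconst l0 + (\<Sum>k=1..m. pmat_inner (\<Lambda> k) (kron_pow M k))" "0 \<le> l0"
    "\<And>k. k \<in> {1..m} \<Longrightarrow> \<Lambda> k \<in> psd_mats (dim_row M ^ k)"
    unfolding kron_cone_def by blast
  define \<Lambda>' where "\<Lambda>' k = (if k \<le> m then \<Lambda> k else 0\<^sub>m (dim_row M ^ k) (dim_row M ^ k))" for k
  have "(\<Sum>k=1..m'. pmat_inner (\<Lambda>' k) (kron_pow M k)) = (\<Sum>k=1..m. pmat_inner (\<Lambda> k) (kron_pow M k))"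
    using assms M by (intro sum.mono_neutral_cong_right) (auto simp: \<Lambda>'_def pmat_inner_zero[OF kron_pow_carrier[OF M]])
  then have "h = pconst l0 + (\<Sum>k=1..m'. pmat_inner (\<Lambda>' k) (kron_pow M k))" using h(1) by simp
  moreover have "\<forall>k\<in>{1..m'}. \<Lambda>' k \<in> psd_mats (dim_row M ^ k)"
    using h(3) by (auto simp: \<Lambda>'_def psd_mats_zero)
  ultimately show "h \<in> kron_cone M m'" using h(2) unfolding kron_cone_def by blast
qed

lemma kron_cone_all_const: "0 \<le> a \<Longrightarrow> pconst a \<in> kron_cone_all M"
  unfolding kron_cone_all_def kron_cone_def by (intro UN_I[of 0]) auto

lemma kron_cone_all_inner:
  assumes L: "L \<in> psd_mats (p ^ k)"
  shows "pmat_inner L (kron_pow M k) \<in> kron_cone_all M"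
proof (cases "k = 0")
  case True
  then have "pmat_inner L (kron_pow M k) = pconst (L $$ (0, 0))"
    using L by (simp add: psd_mats_iff pmat_inner_eq_sum[of _ 1])
  moreover have "0 \<le> L $$ (0, 0)"
    using L True psd_fun_nonneg[of 1 "\<lambda>i j. L $$ (i, j)" "\<lambda>_. 1"] by (simp add: psd_mats_iff)
  ultimately show ?thesis using kron_cone_all_const by simp
next
  case False
  let ?\<Lambda> = "\<lambda>l. if l = k then L else 0\<^sub>m (p ^ l) (p ^ l)"
  have "(\<Sum>l=1..k. pmat_inner (?\<Lambda> l) (kron_pow M l)) = (\<Sum>l\<in>{k}. pmat_inner L (kron_pow M l))"
    using False
    by (intro sum.mono_neutral_cong_right) (auto simp: pmat_inner_zero[OF kron_pow_carrier[OF M]])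
  then have "pmat_inner L (kron_pow M k) = pconst 0 + (\<Sum>l=1..k. pmat_inner (?\<Lambda> l) (kron_pow M l))"
    by (simp add: pconst_0)
  moreover have "\<forall>l\<in>{1..k}. ?\<Lambda> l \<in> psd_mats (dim_row M ^ l)"
    using L M by (simp add: psd_mats_zero)
  ultimately have "pmat_inner L (kron_pow M k) \<in> kron_cone M k"
    unfolding kron_cone_def by (intro CollectI exI[of _ "0::real"] exI[of _ ?\<Lambda>] conjI order_refl)
  then show ?thesis unfolding kron_cone_all_def by blast
qed

lemma kron_cone_all_add:
  assumes "g \<in> kron_cone_all M" "h \<in> kron_cone_all M"
  shows "g + h \<in> kron_cone_all M"
proof -
  obtain m where m: "g \<in> kron_cone M m" "h \<in> kron_cone M m"
    using assms kron_cone_mono[OF max.cobounded1] kron_cone_mono[OF max.cobounded2]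
    unfolding kron_cone_all_def by blast
  obtain a \<Lambda> where g: "g = pconst a + (\<Sum>k=1..m. pmat_inner (\<Lambda> k) (kron_pow M k))" "0 \<le> a"
    "\<And>k. k \<in> {1..m} \<Longrightarrow> \<Lambda> k \<in> psd_mats (p ^ k)"
    using m(1) M unfolding kron_cone_def by auto
  obtain b \<Lambda>' where h: "h = pconst b + (\<Sum>k=1..m. pmat_inner (\<Lambda>' k) (kron_pow M k))" "0 \<le> b"
    "\<And>k. k \<in> {1..m} \<Longrightarrow> \<Lambda>' k \<in> psd_mats (p ^ k)"
    using m(2) M unfolding kron_cone_def by auto
  have "(\<Sum>k=1..m. pmat_inner (\<Lambda> k + \<Lambda>' k) (kron_pow M k))
    = (\<Sum>k=1..m. pmat_inner (\<Lambda> k) (kron_pow M k) + pmat_inner (\<Lambda>' k) (kron_pow M k))"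
    using g(3) h(3) kron_pow_carrier[OF M]
    by (intro sum.cong refl pmat_inner_add) (auto simp: psd_mats_iff)
  then have "g + h = pconst (a + b) + (\<Sum>k=1..m. pmat_inner (\<Lambda> k + \<Lambda>' k) (kron_pow M k))"
    using g(1) h(1) by (simp add: pconst_add sum.distrib ac_simps)
  moreover have "\<forall>k\<in>{1..m}. \<Lambda> k + \<Lambda>' k \<in> psd_mats (dim_row M ^ k)"
    using g(3) h(3) M by (simp add: psd_mats_add)
  ultimately have "g + h \<in> kron_cone M m"
    using g(2) h(2) unfolding kron_cone_def
    by (intro CollectI exI[of _ "a + b"] exI[of _ "\<lambda>k. \<Lambda> k + \<Lambda>' k"]) simp
  then show ?thesis unfolding kron_cone_all_def by blast
qed

lemma kron_cone_all_sum:
  "(\<And>i. i \<in> I \<Longrightarrow> g i \<in> kron_cone_all M) \<Longrightarrow> sum g I \<in> kron_cone_all M"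
  using kron_cone_all_const[of 0]
  by (induction I rule: infinite_finite_induct) (auto simp: pconst_0 intro: kron_cone_all_add)

text \<open>Absorbing the constant term as the summand \<open>k = 0\<close>, whose Kronecker power is the \<open>1 \<times> 1\<close>
  identity, lets all summands be treated alike.\<close>

lemma kron_cone_allE:
  assumes "h \<in> kron_cone_all M"
  obtains m \<Lambda> where "h = (\<Sum>k\<le>m. pmat_inner (\<Lambda> k) (kron_pow M k))"
    "\<And>k. \<Lambda> k \<in> psd_mats (p ^ k)"
proof -
  obtain m a \<Lambda> where h: "h = pconst a + (\<Sum>k=1..m. pmat_inner (\<Lambda> k) (kron_pow M k))" "0 \<le> a"
    "\<And>k. k \<in> {1..m} \<Longrightarrow> \<Lambda> k \<in> psd_mats (p ^ k)"
    using assms M unfolding kron_cone_all_def kron_cone_def by auto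
  define \<Lambda>' where "\<Lambda>' k = (if k = 0 then a \<cdot>\<^sub>m 1\<^sub>m 1 else if k \<le> m then \<Lambda> k else 0\<^sub>m (p ^ k) (p ^ k))" for k
  have one: "1\<^sub>m 1 \<in> psd_mats 1" by (simp add: psd_mats_iff psd_fun_def)
  have "pmat_inner (\<Lambda>' 0) (kron_pow M 0) = pconst a"
    by (simp add: \<Lambda>'_def pmat_inner_eq_sum[of _ 1])
  moreover have "(\<Sum>k=1..m. pmat_inner (\<Lambda>' k) (kron_pow M k)) = (\<Sum>k=1..m. pmat_inner (\<Lambda> k) (kron_pow M k))"
    by (intro sum.cong) (auto simp: \<Lambda>'_def)
  moreover have "{..m} = insert 0 {1..m}" by auto
  ultimately have "h = (\<Sum>k\<le>m. pmat_inner (\<Lambda>' k) (kron_pow M k))" using h(1) by simp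
  moreover have "\<Lambda>' k \<in> psd_mats (p ^ k)" for k
    using h(3)[of k] psd_mats_smult[OF h(2) one] by (simp add: \<Lambda>'_def psd_mats_zero)
  ultimately show thesis by (rule that)
qed

lemma kron_cone_all_mult:
  assumes "g \<in> kron_cone_all M" "h \<in> kron_cone_all M"
  shows "g * h \<in> kron_cone_all M"
proof -
  obtain m \<Lambda> where g: "g = (\<Sum>k\<le>m. pmat_inner (\<Lambda> k) (kron_pow M k))" "\<And>k. \<Lambda> k \<in> psd_mats (p ^ k)"
    using assms(1) by (rule kron_cone_allE) blast
  obtain m' \<Lambda>' where h: "h = (\<Sum>k\<le>m'. pmat_inner (\<Lambda>' k) (kron_pow M k))" "\<And>k. \<Lambda>' k \<in> psd_mats (p ^ k)"
    using assms(2) by (rule kron_cone_allE) blast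
  have "pmat_inner (\<Lambda> k) (kron_pow M k) * pmat_inner (\<Lambda>' l) (kron_pow M l) \<in> kron_cone_all M" for k l
  proof -
    have "pmat_inner (\<Lambda> k) (kron_pow M k) * pmat_inner (\<Lambda>' l) (kron_pow M l)
      = pmat_inner (kronecker (\<Lambda> k) (\<Lambda>' l)) (kron_pow M (k + l))"
      using g(2)[of k] h(2)[of l] kron_pow_carrier[OF M]
      by (subst pmat_inner_mult) (auto simp: psd_mats_iff kron_pow_add[OF M])
    then show ?thesis
      using kron_cone_all_inner[of "kronecker (\<Lambda> k) (\<Lambda>' l)" "k + l"] psd_mats_kronecker[OF g(2) h(2)]
      by (simp add: power_add)
  qed
  then show ?thesis unfolding g(1) h(1) sum_product by (intro kron_cone_all_sum)
qed

lemma kron_cone_all_nonneg: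
  assumes "pmat_eval M x \<in> psd_mats p" "h \<in> kron_cone_all M"
  shows "0 \<le> peval h x"
proof -
  obtain m \<Lambda> where h: "h = (\<Sum>k\<le>m. pmat_inner (\<Lambda> k) (kron_pow M k))" "\<And>k. \<Lambda> k \<in> psd_mats (p ^ k)"
    using assms(2) by (rule kron_cone_allE) blast
  have "0 \<le> peval (pmat_inner (\<Lambda> k) (kron_pow M k)) x" for k
  proof -
    have "\<Lambda> k \<in> carrier_mat (p ^ k) (p ^ k)" using h(2)[of k] by (simp add: psd_mats_iff)
    note eq = peval_pmat_inner[OF this kron_pow_carrier[OF M]]
    show ?thesis
      unfolding eq pmat_eval_kron_pow
      by (rule psd_fun_inner_nonneg) (use h(2)[of k] psd_mats_kron_pow[OF assms(1), of k] in \<open>simp_all only: psd_mats_iff\<close>)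
  qed
  then show ?thesis unfolding h(1) by (simp add: sum_nonneg)
qed

text \<open>The rank one weights \<open>\<Lambda>\<^sub>1 = u u\<^sup>T\<close> give the polynomials \<open>u\<^sup>T M u\<close>, so nonnegativity on the first
  level already forces semidefiniteness.\<close>

lemma nonneg_on_kron_cone_all:
  assumes sym: "sym_mat M" and nonneg: "\<And>h. h \<in> kron_cone_all M \<Longrightarrow> 0 \<le> peval h x"
  shows "pmat_eval M x \<in> psd_mats p"
proof -
  have "psd_fun p (\<lambda>i j. pmat_eval M x $$ (i, j))"
    unfolding psd_fun_def
  proof (intro conjI allI impI)
    show "pmat_eval M x $$ (i, j) = pmat_eval M x $$ (j, i)" if "i < p" "j < p" for i j
    proof -
      have "M $$ (i, j) = M $$ (j, i)"
        using sym_mat_index[OF sym M] that by blast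
      then show ?thesis using that M by (simp add: pmat_eval_index)
    qed
    fix u :: "nat \<Rightarrow> real"
    let ?U = "Matrix.mat p p (\<lambda>(i, j). u i * u j)"
    have "?U \<in> psd_mats (p ^ 1)" using psd_mats_rank_one[of p u] by simp
    then have "0 \<le> peval (pmat_inner ?U M) x"
      using nonneg kron_cone_all_inner[of ?U 1] kron_pow_one[OF M] by simp
    then show "0 \<le> (\<Sum>i<p. \<Sum>j<p. pmat_eval M x $$ (i, j) * (u i * u j))"
      using M by (simp add: peval_pmat_inner[of _ p] mult.commute)
  qed
  then show ?thesis using pmat_eval_carrier[OF M] by (simp add: psd_mats_iff)
qed

end

lemma preprime_kron_cone_all:
  assumes "M \<in> carrier_mat p p"
  shows "preprime pconst (kron_cone_all (M :: 'n::finite rpoly mat))"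
  by unfold_locales
    (auto simp: pconst_add pconst_mult pconst_1
      intro: kron_cone_all_const[OF assms] kron_cone_all_add[OF assms] kron_cone_all_mult[OF assms])

text \<open>A character of the polynomial ring is evaluation at a point, and nonnegativity on the cone
  means that \<open>M\<close> is positive semidefinite there.\<close>

lemma archimedean_kron_cone_positivstellensatz:
  fixes f :: "'n::finite rpoly"
  assumes M: "M \<in> carrier_mat p p" "sym_mat M"
    and arch: "\<And>h. \<exists>N. pconst N - h \<in> kron_cone_all M"
    and pos: "\<And>x. pmat_eval M x \<in> psd_mats p \<Longrightarrow> 0 < peval f x"
  shows "f \<in> kron_cone_all M"
proof -
  interpret preprime pconst "kron_cone_all M"
    by (rule preprime_kron_cone_all[OF M(1)])
  interpret archimedean_preprime pconst "kron_cone_all M"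
    by unfold_locales (rule arch)
  show ?thesis
  proof (rule positive_on_characters_imp_mem)
    fix \<phi> :: "'n rpoly \<Rightarrow> real"
    assume \<phi>: "\<And>a. \<phi> (pconst a) = a" "\<And>p q. \<phi> (p + q) = \<phi> p + \<phi> q"
      "\<And>p q. \<phi> (p * q) = \<phi> p * \<phi> q" "\<And>t. t \<in> kron_cone_all M \<Longrightarrow> 0 \<le> \<phi> t"
    define x where "x = vec_lambda (\<lambda>i. \<phi> (pvar i))"
    have x: "\<phi> h = peval h x" for h
      unfolding x_def by (rule character_eq_peval[OF \<phi>(1-3)])
    have "pmat_eval M x \<in> psd_mats p"
      using nonneg_on_kron_cone_all[OF M(1,2)] \<phi>(4) x by simp
    then show "0 < \<phi> f" using pos x by simp
  qed
qed

section \<open>The Archimedean property\<close>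

text \<open>The pairing of \<open>b I - \<Lambda>\<close> with \<open>M\<^sup>\<otimes>\<^sup>k\<close> is \<open>b t\<^sup>k - \<langle>\<Lambda>, M\<^sup>\<otimes>\<^sup>k\<rangle>\<close>, since the trace is multiplicative on
  Kronecker products; \<open>b\<close> is chosen such that \<open>b I - \<Lambda>\<close> is positive semidefinite.\<close>

lemma constant_trace_bound:
  fixes M :: "'n::finite rpoly mat"
  assumes M: "M \<in> carrier_mat p p" and tr: "(\<Sum>i<p. M $$ (i, i)) = pconst t"
    and h: "h \<in> kron_cone_all M"
  shows "\<exists>N. pconst N - h \<in> kron_cone_all M"
proof -
  obtain m \<Lambda> where h: "h = (\<Sum>k\<le>m. pmat_inner (\<Lambda> k) (kron_pow M k))" "\<And>k. \<Lambda> k \<in> psd_mats (p ^ k)"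
    using kron_cone_allE[OF M h] by blast
  have "\<exists>N. pconst N - pmat_inner (\<Lambda> k) (kron_pow M k) \<in> kron_cone_all M" for k
  proof -
    define r where "r = p ^ k"
    define L where "L = \<Lambda> k"
    define P where "P = kron_pow M k"
    have L: "L \<in> carrier_mat r r" "psd_fun r (\<lambda>i j. L $$ (i, j))"
      using h(2)[of k] by (simp_all add: psd_mats_iff r_def L_def)
    have P: "P \<in> carrier_mat r r" using kron_pow_carrier[OF M] by (simp add: P_def r_def)
    define b where "b = (\<Sum>i<r. \<Sum>j<r. \<bar>L $$ (i, j)\<bar>)"
    define D where "D = Matrix.mat r r (\<lambda>(i, j). (if i = j then b else 0) - L $$ (i, j))"
    have "psd_fun r (\<lambda>i j. (if i = j then b else 0) - L $$ (i, j))"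
      unfolding b_def by (rule psd_fun_diagonal_minus) (rule psd_fun_sym[OF L(2)])
    then have D: "D \<in> psd_mats r" by (simp add: psd_mats_iff D_def psd_fun_def)
    have "pmat_inner D P = (\<Sum>i<r. \<Sum>j<r. (if i = j then pconst b * P $$ (i, j) else 0)) - pmat_inner L P"
    proof -
      have "pconst (D $$ (i, j)) * P $$ (i, j)
          = (if i = j then pconst b * P $$ (i, j) else 0) - pconst (L $$ (i, j)) * P $$ (i, j)"
        if "i < r" "j < r" for i j
        using that by (simp add: D_def pconst_diff pconst_0 left_diff_distrib)
      moreover have "D \<in> carrier_mat r r" by (simp add: D_def)
      ultimately show ?thesis using L(1) P by (simp add: pmat_inner_eq_sum[of _ r] sum_subtractf)
    qed
    also have "(\<Sum>i<r. \<Sum>j<r. (if i = j then pconst b * P $$ (i, j) else 0)) = pconst b * (\<Sum>i<r. P $$ (i, i))"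
      by (simp add: sum_distrib_left)
    also have "(\<Sum>i<r. P $$ (i, i)) = pconst t ^ k"
      unfolding r_def P_def kron_pow_trace[OF M] tr ..
    also have "pconst t ^ k = pconst (t ^ k)"
      by (induction k) (simp_all add: pconst_1 pconst_mult)
    finally have "pconst (b * t ^ k) - pmat_inner L P = pmat_inner D P" by (simp add: pconst_mult)
    also have "\<dots> \<in> kron_cone_all M"
      using kron_cone_all_inner[OF M, of D k] D by (simp add: r_def P_def)
    finally show ?thesis unfolding L_def P_def by blast
  qed
  then obtain N where N: "\<And>k. pconst (N k) - pmat_inner (\<Lambda> k) (kron_pow M k) \<in> kron_cone_all M"
    by metis
  have "pconst (\<Sum>k\<le>m. N k) - h = (\<Sum>k\<le>m. pconst (N k) - pmat_inner (\<Lambda> k) (kron_pow M k))"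
    by (simp add: h(1) pconst_sum sum_subtractf)
  also have "\<dots> \<in> kron_cone_all M" by (intro kron_cone_all_sum[OF M] N)
  finally show ?thesis by blast
qed

lemma sum_lessThan_add:
  fixes g :: "nat \<Rightarrow> 'b::comm_monoid_add"
  shows "(\<Sum>i<m + n. g i) = (\<Sum>i<m. g i) + (\<Sum>i<n. g (m + i))"
  by (induction n) (simp_all add: add.assoc)

lemma psd_fun_block_diagonal:
  assumes A: "\<And>i j. i < m \<Longrightarrow> j < m \<Longrightarrow> C i j = A i j"
    and B: "\<And>i j. i < n \<Longrightarrow> j < n \<Longrightarrow> C (m + i) (m + j) = B i j"
    and 0: "\<And>i j. i < m \<Longrightarrow> j < n \<Longrightarrow> C i (m + j) = 0 \<and> C (m + j) i = 0"
  shows "psd_fun (m + n) C \<longleftrightarrow> psd_fun m A \<and> psd_fun n B"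
proof -
  have quad: "(\<Sum>i<m + n. \<Sum>j<m + n. C i j * (u i * u j))
    = (\<Sum>i<m. \<Sum>j<m. A i j * (u i * u j)) + (\<Sum>i<n. \<Sum>j<n. B i j * (u (m + i) * u (m + j)))" for u
    unfolding sum_lessThan_add using assms by simp
  show ?thesis
  proof (intro iffI conjI)
    assume C: "psd_fun (m + n) C"
    show "psd_fun m A"
      unfolding psd_fun_def
    proof (intro conjI allI impI)
      fix u :: "nat \<Rightarrow> real"
      have "0 \<le> (\<Sum>i<m + n. \<Sum>j<m + n. C i j * ((if i < m then u i else 0) * (if j < m then u j else 0)))"
        by (rule psd_fun_nonneg[OF C])
      then show "0 \<le> (\<Sum>i<m. \<Sum>j<m. A i j * (u i * u j))" unfolding quad by simp
      show "A i j = A j i" if "i < m" "j < m" for i j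
        using psd_fun_sym[OF C, of i j] A that by simp
    qed
    show "psd_fun n B"
      unfolding psd_fun_def
    proof (intro conjI allI impI)
      fix u :: "nat \<Rightarrow> real"
      have "0 \<le> (\<Sum>i<m + n. \<Sum>j<m + n. C i j * ((if i < m then 0 else u (i - m)) * (if j < m then 0 else u (j - m))))"
        by (rule psd_fun_nonneg[OF C])
      then show "0 \<le> (\<Sum>i<n. \<Sum>j<n. B i j * (u i * u j))" unfolding quad by simp
      show "B i j = B j i" if "i < n" "j < n" for i j
        using psd_fun_sym[OF C, of "m + i" "m + j"] B that by simp
    qed
  next
    assume AB: "psd_fun m A \<and> psd_fun n B"
    show "psd_fun (m + n) C"
      unfolding psd_fun_def
    proof (intro conjI allI impI)
      show "C i j = C j i" if "i < m + n" "j < m + n" for i j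
      proof -
        consider "i < m" "j < m" | "i < m" "\<not> j < m" | "\<not> i < m" "j < m" | "\<not> i < m" "\<not> j < m" by blast
        then show ?thesis
        proof cases
          case 1
          then show ?thesis using A AB by (simp add: psd_fun_def)
        next
          case 2
          then show ?thesis using 0[of i "j - m"] that by simp
        next
          case 3
          then show ?thesis using 0[of j "i - m"] that by simp
        next
          case 4
          then show ?thesis
            using B[of "i - m" "j - m"] B[of "j - m" "i - m"] AB that by (simp add: psd_fun_def)
        qed
      qed
      fix u :: "nat \<Rightarrow> real"
      show "0 \<le> (\<Sum>i<m + n. \<Sum>j<m + n. C i j * (u i * u j))"
        unfolding quad using AB by (intro add_nonneg_nonneg psd_fun_nonneg) auto
    qed
  qed
qed

context
  fixes G :: "'n::finite rpoly mat" and q :: nat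
  assumes G: "G \<in> carrier_mat q q"
begin

lemma tilde_pmat_carrier: "tilde_pmat G \<in> carrier_mat (q + q) (q + q)"
  using G by (auto simp: tilde_pmat_def Let_def)

lemma tilde_pmat_index:
  assumes "i < q + q" "j < q + q"
  shows "tilde_pmat G $$ (i, j) = (if i < q then if j < q then G $$ (i, j) else 0
    else if j < q then 0 else (1\<^sub>m q - G) $$ (i - q, j - q))"
  using assms G by (auto simp: tilde_pmat_def Let_def)

lemma tilde_pmat_sym:
  assumes "sym_mat G"
  shows "sym_mat (tilde_pmat G)"
proof -
  have sym: "G $$ (i, j) = G $$ (j, i)" if "i < q" "j < q" for i j
    using sym_mat_index[OF assms G] that by blast
  show ?thesis
    unfolding sym_mat_def
  proof (rule eq_matI)
    fix i j assume "i < dim_row (tilde_pmat G)" "j < dim_col (tilde_pmat G)"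
    then have ij: "i < q + q" "j < q + q" using tilde_pmat_carrier by auto
    then show "transpose_mat (tilde_pmat G) $$ (i, j) = tilde_pmat G $$ (i, j)"
      using tilde_pmat_carrier G sym[of i j] sym[of "i - q" "j - q"] by (auto simp: tilde_pmat_index)
  qed (use tilde_pmat_carrier in auto)
qed

lemma tilde_pmat_trace: "(\<Sum>i<q + q. tilde_pmat G $$ (i, i)) = pconst (real q)"
proof -
  have "(\<Sum>i<q + q. tilde_pmat G $$ (i, i)) = (\<Sum>i<q. G $$ (i, i)) + (\<Sum>i<q. 1 - G $$ (i, i))"
    unfolding sum_lessThan_add using G by (simp add: tilde_pmat_index)
  also have "\<dots> = (\<Sum>i<q. pconst 1)"
    by (simp add: sum_subtractf pconst_1)
  also have "\<dots> = pconst (real q)"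
    by (simp only: flip: pconst_sum) simp
  finally show ?thesis .
qed

lemma tilde_pmat_psd_iff:
  "pmat_eval (tilde_pmat G) x \<in> psd_mats (q + q) \<longleftrightarrow>
    pmat_eval G x \<in> psd_mats q \<and> pmat_eval (1\<^sub>m q - G) x \<in> psd_mats q"
proof -
  have G': "1\<^sub>m q - G \<in> carrier_mat q q" using G by (rule minus_carrier_mat)
  show ?thesis
    unfolding psd_mats_iff
    using pmat_eval_carrier[OF tilde_pmat_carrier, of x] pmat_eval_carrier[OF G, of x]
      pmat_eval_carrier[OF G', of x]
    by (simp, intro psd_fun_block_diagonal)
      (simp_all add: pmat_eval_index[OF tilde_pmat_carrier] pmat_eval_index[OF G] pmat_eval_index[OF G']
        tilde_pmat_index del: index_minus_mat)
qed

end

text \<open>A theorem of the alternative: if the convex cone of coefficient vectors \<open>(\<langle>L, A\<^sub>v\<rangle>)\<^sub>v\<close> missed a point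
  \<open>a\<close>, a separating hyperplane would provide a nonzero \<open>d\<close> that is nonnegative on the cone. Testing with
  rank one \<open>L\<close> shows that \<open>\<Sum>\<^sub>v d\<^sub>v A\<^sub>v\<close> is positive semidefinite, so the spectrahedron contains the
  ray from \<open>x0\<close> in direction \<open>d\<close>.\<close>

lemma bounded_spectrahedron_coefficients:
  fixes A :: "'n::finite \<Rightarrow> real mat" and A0 :: "real mat" and a :: "real ^ 'n"
  defines "F \<equiv> \<lambda>x i j. A0 $$ (i, j) + (\<Sum>v\<in>UNIV. A v $$ (i, j) * vec_nth x v)"
  assumes sym: "\<And>v i j. i < q \<Longrightarrow> j < q \<Longrightarrow> A v $$ (i, j) = A v $$ (j, i)"
    and x0: "psd_fun q (F x0)" and bdd: "bounded {x. psd_fun q (F x)}"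
  shows "\<exists>L\<in>psd_mats q. \<forall>v. (\<Sum>i<q. \<Sum>j<q. L $$ (i, j) * A v $$ (i, j)) = vec_nth a v"
proof (rule ccontr)
  define c :: "real mat \<Rightarrow> real ^ 'n" where
    "c L = vec_lambda (\<lambda>v. \<Sum>i<q. \<Sum>j<q. L $$ (i, j) * A v $$ (i, j))" for L
  let ?S = "c ` psd_mats q"
  assume none: "\<not> ?thesis"
  have "a \<notin> ?S"
  proof
    assume "a \<in> ?S"
    then obtain L where "L \<in> psd_mats q" "a = c L" by blast
    then show False using none by (auto simp: c_def)
  qed
  have c_comb: "c (s \<cdot>\<^sub>m L + t \<cdot>\<^sub>m L') = s *\<^sub>R c L + t *\<^sub>R c L'"
    if "L \<in> carrier_mat q q" "L' \<in> carrier_mat q q" for s t L L'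
    using that by (simp add: c_def Finite_Cartesian_Product.vec_eq_iff sum_distrib_left distrib_right sum.distrib mult.assoc)
  have "convex ?S"
  proof (rule convexI)
    fix y z and s t :: real assume "y \<in> ?S" "z \<in> ?S" "0 \<le> s" "0 \<le> t" "s + t = 1"
    then obtain L L' where "L \<in> psd_mats q" "L' \<in> psd_mats q" "y = c L" "z = c L'" by blast
    then have "s *\<^sub>R y + t *\<^sub>R z = c (s \<cdot>\<^sub>m L + t \<cdot>\<^sub>m L')" "s \<cdot>\<^sub>m L + t \<cdot>\<^sub>m L' \<in> psd_mats q"
      using \<open>0 \<le> s\<close> \<open>0 \<le> t\<close> by (auto simp: c_comb psd_mats_iff[THEN iffD1] intro: psd_mats_add psd_mats_smult)
    then show "s *\<^sub>R y + t *\<^sub>R z \<in> ?S" by blast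
  qed
  moreover have "?S \<noteq> {}" using psd_mats_zero by blast
  ultimately obtain d b where d: "d \<noteq> 0" "\<forall>y\<in>?S. b \<le> inner d y"
    using separating_hyperplane_sets[of "{a}" ?S] \<open>a \<notin> ?S\<close> by auto
  \<comment> \<open>The functional is only known to be bounded below on the cone; scaling makes it nonnegative.\<close>
  have nonneg: "0 \<le> inner d (c L)" if L: "L \<in> psd_mats q" for L
  proof (rule ccontr)
    assume neg: "\<not> 0 \<le> inner d (c L)"
    define s where "s = (\<bar>b\<bar> + 1) / - inner d (c L)"
    have s: "0 \<le> s" "s * inner d (c L) = - (\<bar>b\<bar> + 1)" using neg by (auto simp: s_def field_simps)
    have "c (s \<cdot>\<^sub>m L) = s *\<^sub>R c L"
      using L[unfolded psd_mats_iff, THEN conjunct1]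
      by (simp add: c_def Finite_Cartesian_Product.vec_eq_iff sum_distrib_left mult.assoc)
    then have "b \<le> s * inner d (c L)" using d(2) psd_mats_smult[OF s(1) L] by force
    then show False using s(2) by linarith
  qed
  define D where "D i j = (\<Sum>v\<in>UNIV. vec_nth d v * A v $$ (i, j))" for i j
  have "psd_fun q D"
    unfolding psd_fun_def
  proof (intro conjI allI impI)
    show "D i j = D j i" if "i < q" "j < q" for i j using sym that by (simp add: D_def)
    fix u :: "nat \<Rightarrow> real"
    let ?U = "Matrix.mat q q (\<lambda>(i, j). u i * u j)"
    have "inner d (c ?U) = (\<Sum>v\<in>UNIV. \<Sum>i<q. \<Sum>j<q. vec_nth d v * A v $$ (i, j) * (u i * u j))"
      by (simp add: inner_vec_def c_def sum_distrib_left ac_simps)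
    also have "\<dots> = (\<Sum>i<q. \<Sum>v\<in>UNIV. \<Sum>j<q. vec_nth d v * A v $$ (i, j) * (u i * u j))"
      by (rule sum.swap)
    also have "\<dots> = (\<Sum>i<q. \<Sum>j<q. \<Sum>v\<in>UNIV. vec_nth d v * A v $$ (i, j) * (u i * u j))"
      by (intro sum.cong refl sum.swap)
    also have "\<dots> = (\<Sum>i<q. \<Sum>j<q. D i j * (u i * u j))"
      by (simp add: D_def sum_distrib_right)
    finally show "0 \<le> (\<Sum>i<q. \<Sum>j<q. D i j * (u i * u j))"
      using nonneg[OF psd_mats_rank_one] by metis
  qed
  have ray: "psd_fun q (F (x0 + t *\<^sub>R d))" if "0 \<le> t" for t
  proof -
    have F: "F (x0 + t *\<^sub>R d) i j = F x0 i j + t * D i j" for i j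
      by (simp add: F_def D_def distrib_left sum.distrib sum_distrib_left ac_simps)
    have quad: "(\<Sum>i<q. \<Sum>j<q. F (x0 + t *\<^sub>R d) i j * (u i * u j))
      = (\<Sum>i<q. \<Sum>j<q. F x0 i j * (u i * u j)) + t * (\<Sum>i<q. \<Sum>j<q. D i j * (u i * u j))" for u
      by (simp add: F distrib_right sum.distrib sum_distrib_left mult.assoc)
    show ?thesis
      unfolding psd_fun_def quad
      using psd_fun_nonneg[OF x0] psd_fun_nonneg[OF \<open>psd_fun q D\<close>] that
        psd_fun_sym[OF x0] psd_fun_sym[OF \<open>psd_fun q D\<close>]
      by (auto simp: F intro!: add_nonneg_nonneg mult_nonneg_nonneg)
  qed
  obtain B where B: "\<And>x. psd_fun q (F x) \<Longrightarrow> norm x \<le> B"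
    using bdd by (auto simp: bounded_iff)
  define t where "t = (\<bar>B\<bar> + norm x0 + 1) / norm d"
  have t: "0 \<le> t" "t * norm d = \<bar>B\<bar> + norm x0 + 1" using d(1) by (simp_all add: t_def)
  have "t * norm d \<le> norm (x0 + t *\<^sub>R d) + norm x0"
    using norm_triangle_ineq4[of "x0 + t *\<^sub>R d" x0] t(1) by simp
  then show False using B[OF ray[OF t(1)]] t(2) by linarith
qed

text \<open>Choosing \<open>L\<close> with coefficient vector \<open>\<plusminus> e\<^sub>v\<close> makes \<open>\<langle>L, G\<rangle>\<close> equal to \<open>N \<plusminus> x\<^sub>v\<close> for a constant \<open>N\<close>. So the
  variables are bounded, and they generate the polynomial ring.\<close>

lemma linear_archimedean:
  fixes G :: "'n::finite rpoly mat"
  assumes G: "G \<in> carrier_mat q q" and lin: "linear_pmat G"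
    and ne: "feasible G \<noteq> {}" and bdd: "bounded (feasible G)"
  shows "\<exists>N. pconst N - h \<in> kron_cone_all G"
proof -
  have "\<exists>A0 A. A0 \<in> carrier_mat q q \<and> sym_mat A0 \<and> (\<forall>v. A v \<in> carrier_mat q q \<and> sym_mat (A v)) \<and>
      G = Matrix.mat q q (\<lambda>(i, j). pconst (A0 $$ (i, j)) + (\<Sum>v\<in>UNIV. pconst (A v $$ (i, j)) * pvar v))"
    using lin unfolding linear_pmat_def carrier_matD(1)[OF G] .
  then obtain A0 and A :: "'n \<Rightarrow> real mat" where A: "\<forall>v. A v \<in> carrier_mat q q \<and> sym_mat (A v)"
    and GA: "G = Matrix.mat q q (\<lambda>(i, j). pconst (A0 $$ (i, j)) + (\<Sum>v\<in>UNIV. pconst (A v $$ (i, j)) * pvar v))"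
    by (elim exE conjE)
  define F where "F x i j = A0 $$ (i, j) + (\<Sum>v\<in>UNIV. A v $$ (i, j) * vec_nth x v)" for x :: "real ^ 'n" and i j
  have idx: "G $$ (i, j) = pconst (A0 $$ (i, j)) + (\<Sum>v\<in>UNIV. pconst (A v $$ (i, j)) * pvar v)"
    if "i < q" "j < q" for i j
    using that by (subst GA) simp
  have feas: "x \<in> feasible G \<longleftrightarrow> psd_fun q (F x)" for x
  proof -
    have "pmat_eval G x $$ (i, j) = F x i j" if "i < q" "j < q" for i j
      using that by (simp add: pmat_eval_index[OF G] idx F_def)
    then have "psd_fun q (\<lambda>i j. pmat_eval G x $$ (i, j)) \<longleftrightarrow> psd_fun q (F x)"
      by (simp add: psd_fun_def)
    then show ?thesis using G pmat_eval_carrier[OF G, of x] by (simp add: feasible_def psd_mats_iff)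
  qed
  have symA: "A v $$ (i, j) = A v $$ (j, i)" if "i < q" "j < q" for v i j
    using A sym_mat_index that by blast
  obtain x0 where x0: "psd_fun q (F x0)" using ne feas by blast
  have bdd': "bounded {x. psd_fun q (F x)}" using bdd feas by (simp add: Collect_mem_eq flip: feas)
  interpret preprime pconst "kron_cone_all G"
    by (rule preprime_kron_cone_all[OF G])
  have bound: "\<exists>N. pconst N + pconst s * pvar v \<in> kron_cone_all G" for s v
  proof -
    obtain L where L: "L \<in> psd_mats q"
      and a: "\<And>w. (\<Sum>i<q. \<Sum>j<q. L $$ (i, j) * A w $$ (i, j)) = vec_nth (axis v s) w"
      using bounded_spectrahedron_coefficients[OF symA x0[unfolded F_def[abs_def]] bdd'[unfolded F_def[abs_def]], of "axis v s"]
      by blast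
    define N where "N = (\<Sum>i<q. \<Sum>j<q. L $$ (i, j) * A0 $$ (i, j))"
    have "pmat_inner L G = (\<Sum>i<q. \<Sum>j<q. pconst (L $$ (i, j) * A0 $$ (i, j))
        + (\<Sum>w\<in>UNIV. pconst (L $$ (i, j) * A w $$ (i, j)) * pvar w))"
      using L G by (auto simp: pmat_inner_eq_sum[of _ q] psd_mats_iff idx pconst_mult distrib_left
          sum_distrib_left mult.assoc intro!: sum.cong)
    also have "\<dots> = pconst N + (\<Sum>i<q. \<Sum>j<q. \<Sum>w\<in>UNIV. pconst (L $$ (i, j) * A w $$ (i, j)) * pvar w)"
      by (simp add: N_def sum.distrib pconst_sum)
    also have "(\<Sum>i<q. \<Sum>j<q. \<Sum>w\<in>UNIV. pconst (L $$ (i, j) * A w $$ (i, j)) * pvar w)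
        = (\<Sum>i<q. \<Sum>w\<in>UNIV. \<Sum>j<q. pconst (L $$ (i, j) * A w $$ (i, j)) * pvar w)"
      by (intro sum.cong refl sum.swap)
    also have "\<dots> = (\<Sum>w\<in>UNIV. \<Sum>i<q. \<Sum>j<q. pconst (L $$ (i, j) * A w $$ (i, j)) * pvar w)"
      by (rule sum.swap)
    also have "\<dots> = (\<Sum>w\<in>UNIV. pconst (\<Sum>i<q. \<Sum>j<q. L $$ (i, j) * A w $$ (i, j)) * pvar w)"
      by (simp add: pconst_sum sum_distrib_right)
    also have "\<dots> = (\<Sum>w\<in>UNIV. if w = v then pconst s * pvar w else 0)"
      unfolding a by (intro sum.cong) (auto simp: axis_def pconst_0)
    finally have "pmat_inner L G = pconst N + pconst s * pvar v" by simp
    then show ?thesis using kron_cone_all_inner[OF G, of L 1] L kron_pow_one[OF G] by (metis power_one_right)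
  qed
  have "h \<in> bounded_elems"
  proof (induction h rule: rpoly_induct)
    case (const a)
    show ?case by (rule bounded_elems_const)
  next
    case (var v)
    obtain N where N: "pconst N - (- pvar v) \<in> kron_cone_all G"
      using bound[of 1 v] by (auto simp: pconst_1)
    obtain M where M: "pconst M - pvar v \<in> kron_cone_all G"
      using bound[of "- 1" v] by (auto simp: c_minus pconst_1)
    have "pconst (max N M) - pvar v \<in> kron_cone_all G" "pconst (max N M) - (- pvar v) \<in> kron_cone_all G"
      by (rule bound_mono[OF M] bound_mono[OF N], simp)+
    then show ?case unfolding bounded_elems_def by auto
  next
    case (add p q)
    then show ?case by (rule bounded_elems_add)
  next
    case (mult p q)
    then show ?case by (rule bounded_elems_mult)
  qed
  then show ?thesis unfolding bounded_elems_def by blast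
qed

section \<open>Convergence of the relaxations\<close>

lemma kron_cone_relaxations_converge:
  fixes f :: "'n::finite rpoly"
  assumes M: "M \<in> carrier_mat p p" "sym_mat M"
    and arch: "\<And>h. \<exists>N. pconst N - h \<in> kron_cone_all M"
    and feas: "\<And>x. pmat_eval M x \<in> psd_mats p \<longleftrightarrow> x \<in> K"
    and K: "compact K" "K \<noteq> {}"
  defines "v \<equiv> \<lambda>m. Sup (ereal ` {r. f - pconst r \<in> kron_cone M m})"
  shows "incseq v" "v \<longlonglongrightarrow> ereal (LEAST v. v \<in> peval f ` K)"
proof -
  obtain z where z: "z \<in> K" "\<And>y. y \<in> K \<Longrightarrow> peval f z \<le> peval f y"
    using continuous_attains_inf[OF K continuous_on_peval] by blast
  have least: "(LEAST v. v \<in> peval f ` K) = peval f z"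
    by (rule Least_equality) (use z in auto)
  show inc: "incseq v"
    unfolding v_def incseq_def using kron_cone_mono[OF M(1)]
    by (intro allI impI Sup_subset_mono image_mono) blast
  have le: "v m \<le> peval f z" for m
    unfolding v_def
  proof (rule Sup_least, safe)
    fix r assume "f - pconst r \<in> kron_cone M m"
    then have "f - pconst r \<in> kron_cone_all M" by (auto simp: kron_cone_all_def)
    then have "0 \<le> peval (f - pconst r) z"
      using kron_cone_all_nonneg[OF M(1)] feas z(1) by blast
    then show "ereal r \<le> ereal (peval f z)" by simp
  qed
  have "v \<longlonglongrightarrow> ereal (peval f z)"
  proof (rule order_tendstoI)
    fix a assume "a < ereal (peval f z)"
    then obtain r where r: "a < ereal r" "r < peval f z"
      using ereal_dense2 by force
    have "f - pconst r \<in> kron_cone_all M"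
    proof (rule archimedean_kron_cone_positivstellensatz[OF M arch])
      fix x assume "pmat_eval M x \<in> psd_mats p"
      then show "0 < peval (f - pconst r) x" using feas z(2)[of x] r(2) by simp
    qed
    then obtain m where "f - pconst r \<in> kron_cone M m" by (auto simp: kron_cone_all_def)
    then have "ereal r \<le> v m" unfolding v_def by (intro Sup_upper) blast
    then have "\<forall>k\<ge>m. a < v k" using r(1) inc by (meson incseq_def less_le_trans)
    then show "eventually (\<lambda>k. a < v k) sequentially" by (auto simp: eventually_sequentially)
  next
    fix a assume "ereal (peval f z) < a"
    then show "eventually (\<lambda>k. v k < a) sequentially" 
      by (intro always_eventually allI le_less_trans[OF le])
  qed
  then show "v \<longlonglongrightarrow> ereal (LEAST v. v \<in> peval f ` K)" unfolding least .
qed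

theorem theorem4p2:
  fixes f :: "'n::finite rpoly" and G :: "'n rpoly mat" and q :: nat
  assumes G: "G \<in> carrier_mat q q" "sym_mat G"
    and nonempty: "feasible G \<noteq> {}"
    and cases: "(linear_pmat G \<and> compact (feasible G) \<and> interior (feasible G) \<noteq> {}) \<or>
      (\<not> linear_pmat G \<and> compact (feasible G) \<and>
       (\<forall>x\<in>feasible G. pmat_eval (1\<^sub>m q - G) x \<in> psd_mats q) \<and>
       (UNIV :: 'n rpoly set) = {g - h | g h. g \<in> handelman_all G \<and> h \<in> handelman_all G})"
  shows "incseq (relax_val f G) \<and> relax_val f G \<longlonglongrightarrow> ereal (opt_val f G)"
proof -
  have feas: "x \<in> feasible G \<longleftrightarrow> pmat_eval G x \<in> psd_mats q" for x
    using G by (simp add: feasible_def)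
  obtain M p where M: "M \<in> carrier_mat p p" "sym_mat M" "\<And>m. handelman G m = kron_cone M m"
    and arch: "\<And>h. \<exists>N. pconst N - h \<in> kron_cone_all M"
    and feasM: "\<And>x. pmat_eval M x \<in> psd_mats p \<longleftrightarrow> x \<in> feasible G"
  proof (cases "linear_pmat G")
    case True
    then have "bounded (feasible G)" using cases compact_imp_bounded by blast
    then show thesis
      using that[of G q] G True linear_archimedean[OF G(1) True nonempty] feas
      by (simp add: handelman_def)
  next
    case False
    have handelman: "handelman G m = kron_cone (tilde_pmat G) m" for m
      using False by (simp add: handelman_def)
    then have all: "handelman_all G = kron_cone_all (tilde_pmat G)"
      by (simp add: handelman_all_def kron_cone_all_def)
    have "\<exists>N. pconst N - h \<in> kron_cone_all (tilde_pmat G)" for h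
    proof -
      have "h \<in> {g - h | g h. g \<in> handelman_all G \<and> h \<in> handelman_all G}"
        using cases False by blast
      then obtain g g' where g: "h = g - g'" "g \<in> kron_cone_all (tilde_pmat G)" "g' \<in> kron_cone_all (tilde_pmat G)"
        unfolding all by blast
      obtain N where "pconst N - g \<in> kron_cone_all (tilde_pmat G)"
        using constant_trace_bound[OF tilde_pmat_carrier[OF G(1)] tilde_pmat_trace[OF G(1)] g(2)] by blast
      then have "(pconst N - g) + g' \<in> kron_cone_all (tilde_pmat G)"
        using kron_cone_all_add[OF tilde_pmat_carrier[OF G(1)]] g(3) by blast
      moreover have "(pconst N - g) + g' = pconst N - h" using g(1) by simp
      ultimately show ?thesis by metis
    qed
    moreover have "pmat_eval (tilde_pmat G) x \<in> psd_mats (q + q) \<longleftrightarrow> x \<in> feasible G" for x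
      using tilde_pmat_psd_iff[OF G(1)] cases False feas by blast
    ultimately show thesis
      using that[OF tilde_pmat_carrier[OF G(1)] tilde_pmat_sym[OF G] handelman] by blast
  qed
  have relax: "relax_val f G = (\<lambda>m. Sup (ereal ` {r. f - pconst r \<in> kron_cone M m}))"
    by (simp add: relax_val_def M(3) fun_eq_iff)
  have "compact (feasible G)" using cases by blast
  from kron_cone_relaxations_converge[OF M(1,2) arch feasM this nonempty, of f]
  show ?thesis unfolding relax opt_val_def by blast
qed

end
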